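(* Let $\mathcal G$ be a compact, connected, finite metric graph with non-empty Dirichlet vertex set $\mathsf V_{\mathrm D}$ and total length $|\mathcal G|$. Then \[ h(\mathcal G;\mathsf V_{\mathrm D})^2\,T(\mathcal G;\mathsf V_{\mathrm D})<|\mathcal G| . \]
   Context: A compact, connected, finite metric graph consists of finitely many edges $\mathsf e\simeq[0,\ell_{\mathsf e}]$, $0<\ell_{\mathsf e}<\infty$, glued at their endpoints (vertices) to form a connected space; $|\mathcal G|=\sum_{\mathsf e}\ell_{\mathsf e}$. Cheeger constant: $h(\mathcal G;\mathsf V_{\mathrm D})=\inf\frac{|\partial\widetilde{\mathcal G}|}{|\widetilde{\mathcal G}|}$, where the infimum is over all non-empty subgraphs $\widetilde{\mathcal G}$ of $\mathcal G$ with $\widetilde{\mathcal G}\cap\mathsf V_{\mathrm D}=\emptyset$; here a subgraph is a closed subset of $\mathcal G$ that is a finite union of non-degenerate closed intervals contained in edges (edges may be cut at interior points), $|\widetilde{\mathcal G}|$ is its total length, and $|\partial\widetilde{\mathcal G}|$ is the number of points in its boundary in $\mathcal G$. The torsion function $v$ with respect to $\mathsf V_{\mathrm D}$ is the unique function that is continuous on $\mathcal G$, in $H^2$ on each edge, with $-v_{\mathsf e}''=1$ on each edge, $v=0$ on $\mathsf V_{\mathrm D}$, and sum of normal derivatives over all incident edges equal to $0$ at each vertex not in $\mathsf V_{\mathrm D}$. The torsional rigidity is $T(\mathcal G;\mathsf V_{\mathrm D})=\int_{\mathcal G}v\,dx$. *)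

theory Defs
  imports "HOL-Analysis.Analysis"
begin

section \<open>Finite metric graphs\<close>

text \<open>Loops and parallel edges are allowed. The edge \<open>e\<close> is a copy of the interval
  \<open>[0, len e]\<close>, with \<open>0\<close> glued to \<open>src e\<close> and \<open>len e\<close> glued to \<open>tgt e\<close>.\<close>

record ('v, 'e) metric_graph =
  edges :: "'e set"
  src :: "'e \<Rightarrow> 'v"
  tgt :: "'e \<Rightarrow> 'v"
  len :: "'e \<Rightarrow> real"

definition vertices :: "('v, 'e) metric_graph \<Rightarrow> 'v set" where
  "vertices G = src G ` edges G \<union> tgt G ` edges G"

datatype ('v, 'e) point = Vertex 'v | Inner 'e real

definition edge_point :: "('v, 'e) metric_graph \<Rightarrow> 'e \<Rightarrow> real \<Rightarrow> ('v, 'e) point" where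
  "edge_point G e t =
     (if t = 0 then Vertex (src G e) else if t = len G e then Vertex (tgt G e) else Inner e t)"

definition points :: "('v, 'e) metric_graph \<Rightarrow> ('v, 'e) point set" where
  "points G = (\<Union>e\<in>edges G. edge_point G e ` {0..len G e})"

text \<open>The quotient topology of the disjoint union of the edges.\<close>

definition graph_topology :: "('v, 'e) metric_graph \<Rightarrow> ('v, 'e) point topology" where
  "graph_topology G = topology (\<lambda>U. U \<subseteq> points G \<and>
     (\<forall>e\<in>edges G. openin (top_of_set {0..len G e}) {t \<in> {0..len G e}. edge_point G e t \<in> U}))"

lemma openin_graph_topology:
  "openin (graph_topology G) U \<longleftrightarrow> U \<subseteq> points G \<and>
     (\<forall>e\<in>edges G. openin (top_of_set {0..len G e}) {t \<in> {0..len G e}. edge_point G e t \<in> U})"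
proof -
  have "istopology (\<lambda>U. U \<subseteq> points G \<and>
     (\<forall>e\<in>edges G. openin (top_of_set {0..len G e}) {t \<in> {0..len G e}. edge_point G e t \<in> U}))"
    (is "istopology ?P")
    unfolding istopology_def
  proof (intro conjI allI impI)
    fix S T assume "?P S" "?P T"
    moreover have "{t \<in> {0..len G e}. edge_point G e t \<in> S \<inter> T} =
        {t \<in> {0..len G e}. edge_point G e t \<in> S} \<inter> {t \<in> {0..len G e}. edge_point G e t \<in> T}" for e
      by auto
    ultimately show "S \<inter> T \<subseteq> points G"
      and "\<forall>e\<in>edges G. openin (top_of_set {0..len G e}) {t \<in> {0..len G e}. edge_point G e t \<in> S \<inter> T}"
      by (auto simp del: mem_Collect_eq)
  next
    fix K assume "\<forall>S\<in>K. ?P S"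
    moreover have "{t \<in> {0..len G e}. edge_point G e t \<in> \<Union>K} =
        (\<Union>S\<in>K. {t \<in> {0..len G e}. edge_point G e t \<in> S})" for e
      by auto
    ultimately show "\<Union>K \<subseteq> points G"
      and "\<forall>e\<in>edges G. openin (top_of_set {0..len G e}) {t \<in> {0..len G e}. edge_point G e t \<in> \<Union>K}"
      by (auto simp del: mem_Collect_eq UN_iff)
  qed
  then show ?thesis
    unfolding graph_topology_def by (simp add: topology_inverse')
qed

lemma topspace_graph_topology: "topspace (graph_topology G) = points G"
proof -
  have "{t \<in> {0..len G e}. edge_point G e t \<in> points G} = {0..len G e}" if "e \<in> edges G" for e
    using that by (auto simp: points_def)
  then have "openin (graph_topology G) (points G)"
    by (auto simp: openin_graph_topology)
  then show ?thesis
    unfolding topspace_def by (auto simp: openin_graph_topology)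
qed

lemma quotient_map_edge_point:
  "quotient_map (sum_topology (\<lambda>e. top_of_set {0..len G e}) (edges G)) (graph_topology G)
     (\<lambda>(e, t). edge_point G e t)"
proof -
  have *: "{t \<in> {0..len G e}. edge_point G e t \<in> U} =
      {x. (e, x) \<in> {x \<in> Sigma (edges G) (\<lambda>e. {0..len G e}). (\<lambda>(e, t). edge_point G e t) x \<in> U}}"
    if "e \<in> edges G" for e U
    using that by auto
  show ?thesis
    unfolding quotient_map_def topspace_graph_topology openin_graph_topology openin_sum_topology
    by (auto simp: points_def * simp del: mem_Collect_eq) (auto simp: image_iff)
qed

text \<open>Compactness is automatic for finitely many edges of finite length. There are no isolated
  vertices, so \<open>G\<close> is required to have an edge.\<close>

definition compact_connected_graph :: "('v, 'e) metric_graph \<Rightarrow> bool" where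
  "compact_connected_graph G \<longleftrightarrow>
     finite (edges G) \<and> edges G \<noteq> {} \<and> (\<forall>e\<in>edges G. 0 < len G e) \<and>
     connected_space (graph_topology G)"

definition total_length :: "('v, 'e) metric_graph \<Rightarrow> real" where
  "total_length G = (\<Sum>e\<in>edges G. len G e)"

section \<open>The Cheeger constant\<close>

definition subgraph :: "('v, 'e) metric_graph \<Rightarrow> ('v, 'e) point set \<Rightarrow> bool" where
  "subgraph G S \<longleftrightarrow> closedin (graph_topology G) S \<and>
     (\<exists>I. finite I \<and> (\<forall>(e, a, b)\<in>I. e \<in> edges G \<and> 0 \<le> a \<and> a < b \<and> b \<le> len G e) \<and>
          S = (\<Union>(e, a, b)\<in>I. edge_point G e ` {a..b}))"

definition set_length :: "('v, 'e) metric_graph \<Rightarrow> ('v, 'e) point set \<Rightarrow> real" where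
  "set_length G S =
     (\<Sum>e\<in>edges G. measure lborel {t \<in> {0..len G e}. edge_point G e t \<in> S})"

definition boundary_size :: "('v, 'e) metric_graph \<Rightarrow> ('v, 'e) point set \<Rightarrow> nat" where
  "boundary_size G S = card (graph_topology G frontier_of S)"

text \<open>The set of quotients is bounded below by \<open>0\<close>, and it is nonempty as soon as \<open>G\<close> has an edge
  (take a segment inside an edge), so the real infimum is the intended one.\<close>

definition cheeger :: "('v, 'e) metric_graph \<Rightarrow> 'v set \<Rightarrow> real" where
  "cheeger G D = Inf {real (boundary_size G S) / set_length G S | S.
     subgraph G S \<and> S \<noteq> {} \<and> S \<inter> Vertex ` D = {}}"

section \<open>Sobolev spaces on an interval\<close>

text \<open>Weak derivatives are tested against compactly supported \<open>C\<^sup>1\<close> functions, as is usual in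
  dimension one.\<close>

definition test_function :: "real \<Rightarrow> real \<Rightarrow> (real \<Rightarrow> real) \<Rightarrow> bool" where
  "test_function a b \<phi> \<longleftrightarrow> \<phi> C1_differentiable_on UNIV \<and>
     compact (closure {x. \<phi> x \<noteq> 0}) \<and> closure {x. \<phi> x \<noteq> 0} \<subseteq> {a<..<b}"

definition L2_on :: "real \<Rightarrow> real \<Rightarrow> (real \<Rightarrow> real) \<Rightarrow> bool" where
  "L2_on a b f \<longleftrightarrow> f \<in> borel_measurable (lebesgue_on {a<..<b}) \<and>
     integrable (lebesgue_on {a<..<b}) (\<lambda>t. (f t)\<^sup>2)"

definition weak_derivative :: "real \<Rightarrow> real \<Rightarrow> (real \<Rightarrow> real) \<Rightarrow> (real \<Rightarrow> real) \<Rightarrow> bool" where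
  "weak_derivative a b f g \<longleftrightarrow> (\<forall>\<phi>. test_function a b \<phi> \<longrightarrow>
     (LINT t|lebesgue_on {a<..<b}. f t * deriv \<phi> t) =
       - (LINT t|lebesgue_on {a<..<b}. g t * \<phi> t))"

definition H1_on :: "real \<Rightarrow> real \<Rightarrow> (real \<Rightarrow> real) \<Rightarrow> bool" where
  "H1_on a b f \<longleftrightarrow> L2_on a b f \<and> (\<exists>g. L2_on a b g \<and> weak_derivative a b f g)"

definition H2_on :: "real \<Rightarrow> real \<Rightarrow> (real \<Rightarrow> real) \<Rightarrow> bool" where
  "H2_on a b f \<longleftrightarrow> L2_on a b f \<and> (\<exists>g. H1_on a b g \<and> weak_derivative a b f g)"

definition weak_second_derivative :: "real \<Rightarrow> real \<Rightarrow> (real \<Rightarrow> real) \<Rightarrow> (real \<Rightarrow> real) \<Rightarrow> bool" where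
  "weak_second_derivative a b f h \<longleftrightarrow>
     (\<exists>g. L2_on a b g \<and> weak_derivative a b f g \<and> weak_derivative a b g h)"

section \<open>Torsion\<close>

definition on_edge ::
  "('v, 'e) metric_graph \<Rightarrow> (('v, 'e) point \<Rightarrow> real) \<Rightarrow> 'e \<Rightarrow> real \<Rightarrow> real" where
  "on_edge G u e t = u (edge_point G e t)"

text \<open>Derivatives at the end points point into the edge. A loop contributes twice. The one-sided
  derivatives exist because \<open>H\<^sup>2\<close> functions on an interval are \<open>C\<^sup>1\<close> up to the boundary.\<close>

definition normal_derivative_sum ::
  "('v, 'e) metric_graph \<Rightarrow> (('v, 'e) point \<Rightarrow> real) \<Rightarrow> 'v \<Rightarrow> real" where
  "normal_derivative_sum G u x =
     (\<Sum>e | e \<in> edges G \<and> src G e = x.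
        vector_derivative (on_edge G u e) (at 0 within {0..len G e})) +
     (\<Sum>e | e \<in> edges G \<and> tgt G e = x.
        - vector_derivative (on_edge G u e) (at (len G e) within {0..len G e}))"

text \<open>Extensionality fixes the values at elements of the type that are not points of \<open>G\<close>;
  without it the torsion function would not be unique.\<close>

definition is_torsion_function ::
  "('v, 'e) metric_graph \<Rightarrow> 'v set \<Rightarrow> (('v, 'e) point \<Rightarrow> real) \<Rightarrow> bool" where
  "is_torsion_function G D v \<longleftrightarrow>
     v \<in> extensional (points G) \<and>
     continuous_map (graph_topology G) euclideanreal v \<and>
     (\<forall>e\<in>edges G. H2_on 0 (len G e) (on_edge G v e) \<and>
        weak_second_derivative 0 (len G e) (on_edge G v e) (\<lambda>_. - 1)) \<and>
     (\<forall>x\<in>D. v (Vertex x) = 0) \<and>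
     (\<forall>x\<in>vertices G - D. normal_derivative_sum G v x = 0)"

definition torsion_function ::
  "('v, 'e) metric_graph \<Rightarrow> 'v set \<Rightarrow> ('v, 'e) point \<Rightarrow> real" where
  "torsion_function G D = (THE v. is_torsion_function G D v)"

definition torsional_rigidity :: "('v, 'e) metric_graph \<Rightarrow> 'v set \<Rightarrow> real" where
  "torsional_rigidity G D =
     (\<Sum>e\<in>edges G. LINT t|lebesgue_on {0..len G e}. on_edge G (torsion_function G D) e t)"

end

theory Submission
  imports Defs
begin

text \<open>Testing \<open>- v'' = 1\<close> against \<open>v\<close> gives \<open>T = \<integral> v = \<integral> v'\<^sup>2\<close>. For almost every \<open>t > 0\<close> the superlevel set
  \<open>{v \<ge> t}\<close> is a subgraph missing the Dirichlet vertices, with boundary in the level set \<open>{v = t}\<close>;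
  integrating \<open>h \<bar>{v \<ge> t}\<bar> \<le> \<bar>{v = t}\<bar>\<close> over \<open>t\<close> yields \<open>h T \<le> \<integral> \<bar>v'\<bar>\<close>. By Cauchy-Schwarz
  \<open>(\<integral> \<bar>v'\<bar>)\<^sup>2 < \<bar>G\<bar> T\<close>, strictly because \<open>\<bar>v'\<bar>\<close> is not constant. That \<open>v\<close> exists and is unique
  reduces to a square linear system for the vertex values, since on each edge \<open>v\<close> is a quadratic
  polynomial determined by its end values; the homogeneous system has only the zero solution, by
  the Dirichlet energy and connectedness.\<close>

section \<open>Weak solutions on an interval\<close>

text \<open>Since \<open>torsion_function\<close> is a definite description, nothing can be said
  about it before existence and uniqueness are settled. Once it is known to be \<open>parab\<close>
  on each edge, the integrals over an edge become polynomials in its end value, slope and length.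
  Cauchy-Schwarz takes the form of a family of strict inequalities
  \<open>2 * c * V < T + c\<^sup>2 * L\<close>, where V is the total variation of v and L the total
  length. For fixed c both sides are sums over edges, so strictness can be checked on a single edge,
  where the derivative has absolute value c at no more than two points. The sign of v is left open:
  the layer-cake estimate runs over positive levels only and so bounds the positive part of v, while
  \<open>0 < T\<close> comes out of the strict inequality itself.\<close>

lemma continuous_antiderivative:
  fixes k :: "real \<Rightarrow> real"
  assumes "continuous_on UNIV k"
  obtains F where "\<And>x. (F has_real_derivative k x) (at x)"
proof -
  have "\<exists>F. \<forall>x. -\<infinity> < ereal x \<longrightarrow> ereal x < \<infinity> \<longrightarrow> (F has_vector_derivative k x) (at x)"
    by (rule einterval_antiderivative) (use assms in \<open>auto simp: continuous_on_eq_continuous_at\<close>)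
  then show ?thesis
    using that by (auto simp: has_real_derivative_iff_has_vector_derivative)
qed

text \<open>Normalised to vanish at a, the antiderivative vanishes at b by the zero mean and is
  constant beyond both ends. Applied twice, this builds a test function from a prescribed second
  derivative.\<close>

lemma continuous_antiderivative_compact_support:
  fixes k :: "real \<Rightarrow> real"
  assumes cont: "continuous_on UNIV k" and "a < b"
    and supp: "\<And>x. x \<notin> {a..b} \<Longrightarrow> k x = 0" and int0: "integral {a..b} k = 0"
  obtains F where "\<And>x. (F has_real_derivative k x) (at x)" "\<And>x. x \<notin> {a<..<b} \<Longrightarrow> F x = 0"
proof -
  obtain F where F: "\<And>x. (F has_real_derivative k x) (at x)"
    using continuous_antiderivative[OF cont] by blast
  have "(k has_integral F b - F a) {a..b}"
    using F \<open>a < b\<close> by (intro fundamental_theorem_of_calculus)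
      (auto simp: has_real_derivative_iff_has_vector_derivative[symmetric] intro: DERIV_subset)
  then have Fb: "F b = F a"
    using int0 by (simp add: integral_unique)
  have diff0: "F y = F x" if "x < y" and "\<And>z. x < z \<Longrightarrow> z < y \<Longrightarrow> k z = 0" for x y
    using MVT2[OF \<open>x < y\<close>, of F k] F that by auto
  show ?thesis
  proof (rule that[of "\<lambda>x. F x - F a"])
    show "((\<lambda>x. F x - F a) has_real_derivative k x) (at x)" for x
      using F by (auto intro!: derivative_eq_intros)
    show "F x - F a = 0" if "x \<notin> {a<..<b}" for x
    proof -
      consider "x < a" | "x = a" | "x = b" | "b < x" using \<open>x \<notin> {a<..<b}\<close> by fastforce
      then show ?thesis
      proof cases
        case 1 then show ?thesis using diff0[of x a] supp by force
      next
        case 4 then show ?thesis using diff0[of b x] supp Fb by force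
      qed (use Fb in auto)
    qed
  qed
qed

lemma integrable_lebesgue_on_subset:
  fixes f :: "real \<Rightarrow> real"
  assumes "integrable (lebesgue_on T) f" "S \<subseteq> T" "S \<in> sets lebesgue" "T \<in> sets lebesgue"
  shows "integrable (lebesgue_on S) f"
  using set_integrable_subset[of lebesgue T f S] assms
  by (simp add: integrable_restrict_space set_integrable_def)

text \<open>Weak derivatives integrate over the open interval, the torsional rigidity over the
  closed one; both are carried over to the gauge integral, where the fundamental theorem of calculus
  is at hand.\<close>

lemma lebesgue_integral_continuous:
  fixes f :: "real \<Rightarrow> real"
  assumes "continuous_on {a..b} f"
  shows "(LINT t|lebesgue_on {a<..<b}. f t) = integral {a..b} f"
    and "(LINT t|lebesgue_on {a..b}. f t) = integral {a..b} f"
proof -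
  have i: "integrable (lebesgue_on {a..b}) f"
    using assms by (rule continuous_imp_integrable_real)
  then have "integrable (lebesgue_on {a<..<b}) f"
    by (rule integrable_lebesgue_on_subset) auto
  then have "(LINT t|lebesgue_on {a<..<b}. f t) = integral {a<..<b} f"
    by (simp add: lebesgue_integral_eq_integral)
  then show "(LINT t|lebesgue_on {a<..<b}. f t) = integral {a..b} f"
    by (simp add: integral_open_interval_real)
  show "(LINT t|lebesgue_on {a..b}. f t) = integral {a..b} f"
    using i by (simp add: lebesgue_integral_eq_integral)
qed

section \<open>Test functions and integration by parts\<close>

lemma test_functionI:
  assumes "\<And>x. (\<phi> has_real_derivative \<phi>' x) (at x)" "continuous_on UNIV \<phi>'"
    and "\<And>x. x \<notin> {a<..<b} \<Longrightarrow> \<phi> x = 0" "l < a" "b < u"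
  shows "test_function l u \<phi>"
proof -
  have "{x. \<phi> x \<noteq> 0} \<subseteq> {a..b}"
    using assms(3) by (smt (verit) atLeastAtMost_iff greaterThanLessThan_iff mem_Collect_eq subsetI)
  then have "closure {x. \<phi> x \<noteq> 0} \<subseteq> {a..b}"
    by (simp add: closure_minimal)
  moreover from this have "compact (closure {x. \<phi> x \<noteq> 0})"
    by (meson bounded_closed_interval bounded_subset closed_closure compact_eq_bounded_closed)
  moreover have "\<phi> C1_differentiable_on UNIV"
    unfolding C1_differentiable_on_def
    using assms(1,2) by (auto simp: has_real_derivative_iff_has_vector_derivative)
  ultimately show ?thesis
    using assms(4,5) unfolding test_function_def by force
qed

lemma test_functionD:
  assumes "test_function a b \<phi>"
  shows "(\<phi> has_real_derivative deriv \<phi> x) (at x)" "continuous_on UNIV (deriv \<phi>)"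
    and "x \<notin> {a<..<b} \<Longrightarrow> \<phi> x = 0"
proof -
  obtain D where D: "\<And>x. (\<phi> has_real_derivative D x) (at x)" "continuous_on UNIV D"
    using assms unfolding test_function_def C1_differentiable_on_def
    by (auto simp: has_real_derivative_iff_has_vector_derivative)
  then have "deriv \<phi> = D"
    by (auto intro: DERIV_imp_deriv)
  with D show "(\<phi> has_real_derivative deriv \<phi> x) (at x)" "continuous_on UNIV (deriv \<phi>)"
    by auto
  show "x \<notin> {a<..<b} \<Longrightarrow> \<phi> x = 0"
    using assms closure_subset[of "{x. \<phi> x \<noteq> 0}"] unfolding test_function_def by blast
qed

lemma weak_derivative_classical:
  fixes f f' :: "real \<Rightarrow> real"
  assumes "a \<le> b" and f: "\<And>x. x \<in> {a..b} \<Longrightarrow> (f has_real_derivative f' x) (at x within {a..b})"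
    and f': "continuous_on {a..b} f'"
  shows "weak_derivative a b f f'"
  unfolding weak_derivative_def
proof (intro allI impI)
  fix \<phi> assume \<phi>: "test_function a b \<phi>"
  note D = test_functionD[OF \<phi>]
  have cf: "continuous_on {a..b} f"
    using f DERIV_continuous_on by blast
  have c\<phi>: "continuous_on {a..b} \<phi>" "continuous_on {a..b} (deriv \<phi>)"
    using D(1,2) by (auto intro: DERIV_continuous_on continuous_on_subset DERIV_subset)
  have "((\<lambda>t. f t * deriv \<phi> t + f' t * \<phi> t) has_integral f b * \<phi> b - f a * \<phi> a) {a..b}"
    using \<open>a \<le> b\<close>
  proof (rule fundamental_theorem_of_calculus)
    fix x assume "x \<in> {a..b}"
    have "((\<lambda>x. f x * \<phi> x) has_real_derivative f x * deriv \<phi> x + f' x * \<phi> x) (at x within {a..b})"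
      using f[OF \<open>x \<in> {a..b}\<close>] DERIV_subset[OF D(1)] by (auto intro!: derivative_eq_intros)
    then show "((\<lambda>x. f x * \<phi> x) has_vector_derivative f x * deriv \<phi> x + f' x * \<phi> x) (at x within {a..b})"
      by (simp add: has_real_derivative_iff_has_vector_derivative)
  qed
  then have "integral {a..b} (\<lambda>t. f t * deriv \<phi> t + f' t * \<phi> t) = 0"
    using D(3)[of a] D(3)[of b] by (simp add: integral_unique)
  moreover have c: "continuous_on {a..b} (\<lambda>t. f t * deriv \<phi> t)" "continuous_on {a..b} (\<lambda>t. f' t * \<phi> t)"
    using cf c\<phi> f' by (auto intro: continuous_on_mult)
  ultimately have "integral {a..b} (\<lambda>t. f t * deriv \<phi> t) = - integral {a..b} (\<lambda>t. f' t * \<phi> t)"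
    by (simp add: integral_add integrable_continuous_real)
  then show "(LINT t|lebesgue_on {a<..<b}. f t * deriv \<phi> t) = - (LINT t|lebesgue_on {a<..<b}. f' t * \<phi> t)"
    using c by (simp add: lebesgue_integral_continuous)
qed

lemma L2_on_continuous:
  assumes "continuous_on {a..b} f"
  shows "L2_on a b f"
proof -
  have "integrable (lebesgue_on {a<..<b}) f" "integrable (lebesgue_on {a<..<b}) (\<lambda>t. (f t)\<^sup>2)"
    using assms by (auto intro!: integrable_lebesgue_on_subset[of "{a..b}"] continuous_imp_integrable_real continuous_intros)
  then show ?thesis
    unfolding L2_on_def by auto
qed

text \<open>The two vanishing moments are what allows k to be integrated twice with compact support,
  \<open>k = \<phi>''\<close>. Both f and the quadratic have second derivative -1, so each pairs
  with k to \<open>- \<integral> \<phi>\<close>.\<close>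

lemma weak_second_derivative_test:
  fixes f :: "real \<Rightarrow> real"
  assumes f: "continuous_on {0..l} f" and w: "weak_second_derivative 0 l f (\<lambda>_. - 1)"
    and k: "continuous_on UNIV k" "\<And>x. x \<notin> {a..b} \<Longrightarrow> k x = 0"
    and ab: "0 < a" "a < b" "b < l"
    and mom: "integral {a..b} k = 0" "integral {a..b} (\<lambda>t. t * k t) = 0"
  shows "integral {0..l} (\<lambda>t. (f t - (\<alpha> + \<beta> * t - t\<^sup>2 / 2)) * k t) = 0"
proof -
  obtain \<phi>1 where \<phi>1: "\<And>x. (\<phi>1 has_real_derivative k x) (at x)" "\<And>x. x \<notin> {a<..<b} \<Longrightarrow> \<phi>1 x = 0"
    using continuous_antiderivative_compact_support[OF k(1) ab(2) k(2) mom(1)] by blast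
  have c1: "continuous_on S \<phi>1" for S
    using \<phi>1(1) by (blast intro: DERIV_continuous_on has_field_derivative_at_within)
  have ck: "continuous_on S k" for S
    using k(1) continuous_on_subset by blast
  \<comment> \<open>Integrating the derivative of \<open>t * \<phi>1 t\<close> shows that the mean
    of \<open>\<phi>1\<close> is minus the first moment of k, so the second antiderivative also has
    compact support.\<close>
  have "((\<lambda>t. t * k t + \<phi>1 t) has_integral b * \<phi>1 b - a * \<phi>1 a) {a..b}"
    using \<phi>1(1) ab(2) by (intro fundamental_theorem_of_calculus)
      (auto simp: has_real_derivative_iff_has_vector_derivative[symmetric]
        intro!: derivative_eq_intros DERIV_subset[OF \<phi>1(1)])
  then have "integral {a..b} (\<lambda>t. t * k t + \<phi>1 t) = 0"
    using \<phi>1(2)[of a] \<phi>1(2)[of b] by (simp add: integral_unique)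
  then have "integral {a..b} \<phi>1 = 0"
    using mom(2) by (subst (asm) integral_add)
      (auto intro!: integrable_continuous_real continuous_intros ck c1)
  moreover have "\<phi>1 x = 0" if "x \<notin> {a..b}" for x
    using that by (intro \<phi>1(2)) auto
  ultimately obtain \<phi> where \<phi>: "\<And>x. (\<phi> has_real_derivative \<phi>1 x) (at x)" "\<And>x. x \<notin> {a<..<b} \<Longrightarrow> \<phi> x = 0"
    using continuous_antiderivative_compact_support[OF c1 ab(2)] by blast
  have c0: "continuous_on S \<phi>" for S
    using \<phi>(1) by (blast intro: DERIV_continuous_on has_field_derivative_at_within)
  have t: "test_function 0 l \<phi>" "test_function 0 l \<phi>1"
    using test_functionI[OF \<phi>(1) c1 \<phi>(2) ab(1,3)] test_functionI[OF \<phi>1(1) k(1) \<phi>1(2) ab(1,3)] by auto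
  have d: "deriv \<phi> = \<phi>1" "deriv \<phi>1 = k"
    using \<phi>(1) \<phi>1(1) by (auto intro: DERIV_imp_deriv)
  obtain g where g: "weak_derivative 0 l f g" "weak_derivative 0 l g (\<lambda>_. - 1)"
    using w unfolding weak_second_derivative_def by blast
  have "(LINT t|lebesgue_on {0<..<l}. f t * k t) = - (LINT t|lebesgue_on {0<..<l}. \<phi> t)"
    using g t d unfolding weak_derivative_def by fastforce
  then have fk: "integral {0..l} (\<lambda>t. f t * k t) = - integral {0..l} \<phi>"
    by (subst (asm) (1 2) lebesgue_integral_continuous(1)) (auto intro!: continuous_intros f ck c0)
  define P where "P t = \<alpha> + \<beta> * t - t\<^sup>2 / 2" for t :: real
  have cP: "continuous_on S P" for S
    unfolding P_def by (auto intro!: continuous_intros)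
  \<comment> \<open>The primitive is \<open>P * \<phi>1 - P' * \<phi>\<close>, where
    \<open>P' t = \<beta> - t\<close> and \<open>P'' = - 1\<close>.\<close>
  have "((\<lambda>t. P t * k t + \<phi> t) has_integral
      (P l * \<phi>1 l - (\<beta> - l) * \<phi> l) - (P 0 * \<phi>1 0 - (\<beta> - 0) * \<phi> 0)) {0..l}"
    using ab by (intro fundamental_theorem_of_calculus)
      (auto simp: has_real_derivative_iff_has_vector_derivative[symmetric] P_def field_simps
        intro!: derivative_eq_intros DERIV_subset[OF \<phi>1(1)] DERIV_subset[OF \<phi>(1)])
  then have "integral {0..l} (\<lambda>t. P t * k t + \<phi> t) = 0"
    using \<phi>1(2)[of 0] \<phi>1(2)[of l] \<phi>(2)[of 0] \<phi>(2)[of l] ab by (simp add: integral_unique)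
  then have "integral {0..l} (\<lambda>t. P t * k t) = - integral {0..l} \<phi>"
    by (subst (asm) integral_add) (auto intro!: integrable_continuous_real continuous_intros ck c0 cP)
  with fk have "integral {0..l} (\<lambda>t. f t * k t - P t * k t) = 0"
    by (subst integral_diff) (auto intro!: integrable_continuous_real continuous_intros ck f cP)
  then show ?thesis
    by (simp add: P_def left_diff_distrib)
qed

lemma integral_nonneg_eq_0:
  fixes f :: "real \<Rightarrow> real"
  assumes "continuous_on {a..b} f" "a < b" "\<And>x. x \<in> {a..b} \<Longrightarrow> 0 \<le> f x"
    and "integral {a..b} f = 0" "x \<in> {a..b}"
  shows "f x = 0"
proof -
  have "(f has_integral 0) (cbox a b)"
    using assms(1,4) by (simp add: has_integral_iff integrable_continuous_real)
  with assms show ?thesis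
    by (intro has_integral_0_cbox_imp_0[of a b f x]) auto
qed

lemma integral_pos_continuous:
  fixes f :: "real \<Rightarrow> real"
  assumes "continuous_on {a..b} f" "a < b" "\<And>x. x \<in> {a..b} \<Longrightarrow> 0 \<le> f x"
    and "x \<in> {a..b}" "f x \<noteq> 0"
  shows "0 < integral {a..b} f"
  using integral_nonneg_eq_0[of a b f x] integral_nonneg[of f "{a..b}"] assms
  by (force simp: integrable_continuous_real)

text \<open>The weight \<open>\<eta>\<close> vanishes at both ends, so \<open>\<eta> u\<close> extended by \<open>0\<close> is continuous. Taking for \<open>u\<close> the
  error of the \<open>\<eta>\<close>-weighted least-squares affine fit of \<open>f + t\<^sup>2 / 2\<close> makes \<open>\<eta> u\<close> the second derivative
  of a test function, and testing with it gives \<open>\<integral> \<eta> u\<^sup>2 = 0\<close>.\<close>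

lemma weak_second_derivative_inner:
  fixes f :: "real \<Rightarrow> real"
  assumes f: "continuous_on {0..l} f" and w: "weak_second_derivative 0 l f (\<lambda>_. - 1)"
    and ab: "0 < a" "a < b" "b < l"
  obtains \<alpha> \<beta> where "\<And>t. t \<in> {a..b} \<Longrightarrow> f t = \<alpha> + \<beta> * t - t\<^sup>2 / 2"
proof -
  define m where "m = (a + b) / 2"
  define \<eta> where "\<eta> t = (t - a) * (b - t)" for t
  define F where "F t = f t + t\<^sup>2 / 2" for t
  define J where "J = (\<lambda>g :: real \<Rightarrow> real. integral {a..b} (\<lambda>t. \<eta> t * g t))"
  have c\<eta>: "continuous_on S \<eta>" for S
    unfolding \<eta>_def by (auto intro!: continuous_intros)
  have fab: "continuous_on {a..b} f"
    using f ab by (auto intro: continuous_on_subset)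
  then have cF: "continuous_on {a..b} F"
    unfolding F_def by (auto intro!: continuous_intros)
  have \<eta>0: "0 < \<eta> t" if "a < t" "t < b" for t
    using that by (simp add: \<eta>_def)
  have \<eta>_nonneg: "0 \<le> \<eta> t" if "t \<in> {a..b}" for t
    using that by (simp add: \<eta>_def)
  have m: "a < m" "m < b"
    using ab by (auto simp: m_def)
  have J0: "0 < J (\<lambda>t. 1)"
    unfolding J_def using \<eta>0[of m] \<eta>_nonneg m
    by (intro integral_pos_continuous[of _ _ _ m]) (auto intro!: continuous_intros c\<eta>)
  have J1: "J (\<lambda>t. t - m) = 0"
  proof -
    \<comment> \<open>\<open>\<eta>' t = - 2 * (t - m)\<close>, so
      \<open>- \<eta>\<^sup>2 / 4\<close> is a primitive.\<close>
    have "((\<lambda>t. \<eta> t * (t - m)) has_integral - (\<eta> b)\<^sup>2 / 4 - - (\<eta> a)\<^sup>2 / 4) {a..b}"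
      using ab by (intro fundamental_theorem_of_calculus)
       (auto simp: has_real_derivative_iff_has_vector_derivative[symmetric] \<eta>_def m_def field_simps
          intro!: derivative_eq_intros)
    then show ?thesis by (simp add: J_def integral_unique \<eta>_def)
  qed
  have J2: "0 < J (\<lambda>t. (t - m)\<^sup>2)"
    unfolding J_def
  proof (rule integral_pos_continuous)
    \<comment> \<open>The midpoint m is no witness here, since \<open>(t - m)\<^sup>2\<close>
      vanishes at it.\<close>
    show "(a + m) / 2 \<in> {a..b}" "\<eta> ((a + m) / 2) * ((a + m) / 2 - m)\<^sup>2 \<noteq> 0"
      using \<eta>0[of "(a + m) / 2"] m by auto
  qed (use ab \<eta>_nonneg in \<open>auto intro!: continuous_intros c\<eta>\<close>)
  \<comment> \<open>By \<open>J1\<close> the functions 1 and \<open>t - m\<close> are orthogonal for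
    the weight \<eta>, so the normal equations of the fit decouple into two quotients.\<close>
  define c0 where "c0 = J F / J (\<lambda>t. 1)"
  define c1 where "c1 = J (\<lambda>t. F t * (t - m)) / J (\<lambda>t. (t - m)\<^sup>2)"
  define u where "u t = F t - (c0 + c1 * (t - m))" for t
  have cu: "continuous_on {a..b} u"
    unfolding u_def by (auto intro!: continuous_intros cF)
  have lin: "J (\<lambda>t. g t - (c * p t + d * q t)) = J g - (c * J p + d * J q)"
    if "continuous_on {a..b} g" "continuous_on {a..b} p" "continuous_on {a..b} q" for g p q c d
  proof -
    have i: "(\<lambda>t. \<eta> t * g t) integrable_on {a..b}" "(\<lambda>t. c * (\<eta> t * p t)) integrable_on {a..b}"
      "(\<lambda>t. d * (\<eta> t * q t)) integrable_on {a..b}"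
      by (auto intro!: integrable_continuous_real continuous_intros that c\<eta>)
    have "J (\<lambda>t. g t - (c * p t + d * q t)) =
      integral {a..b} (\<lambda>t. \<eta> t * g t - (c * (\<eta> t * p t) + d * (\<eta> t * q t)))"
      unfolding J_def by (simp add: algebra_simps)
    also have "\<dots> = J g - (c * J p + d * J q)"
      unfolding J_def using i by (simp add: integral_diff integral_add integrable_add)
    finally show ?thesis .
  qed
  have u0: "J u = 0"
    using lin[OF cF, of "\<lambda>_. 1" "\<lambda>t. t - m" c0 c1] J0 J1 
    by (simp add: u_def[abs_def] c0_def continuous_intros)
  have u1: "J (\<lambda>t. u t * (t - m)) = 0"
  proof -
    have "J (\<lambda>t. u t * (t - m)) = J (\<lambda>t. F t * (t - m) - (c0 * (t - m) + c1 * (t - m)\<^sup>2))"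
      by (simp add: u_def algebra_simps power2_eq_square)
    also have "\<dots> = J (\<lambda>t. F t * (t - m)) - (c0 * J (\<lambda>t. t - m) + c1 * J (\<lambda>t. (t - m)\<^sup>2))"
      by (rule lin) (auto intro!: continuous_intros cF)
    finally show ?thesis using J1 J2 by (simp add: c1_def)
  qed
  have "J (\<lambda>t. u t * (t - m)) = integral {a..b} (\<lambda>t. t * (\<eta> t * u t) - m * (\<eta> t * u t))"
    unfolding J_def by (simp add: algebra_simps)
  also have "\<dots> = integral {a..b} (\<lambda>t. t * (\<eta> t * u t)) - m * J u"
    unfolding J_def by (subst integral_diff)
      (auto intro!: integrable_continuous_real continuous_intros cu c\<eta>)
  finally have u1': "integral {a..b} (\<lambda>t. t * (\<eta> t * u t)) = 0"
    using u0 u1 by simp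
  \<comment> \<open>Clamping the argument keeps u where its continuity is known; outside
    \<open>{a..b}\<close> the factor \<open>max 0 (\<eta> t)\<close> is zero.\<close>
  define k where "k t = max 0 (\<eta> t) * u (max a (min b t))" for t
  have k_eq: "k t = \<eta> t * u t" if "t \<in> {a..b}" for t
    using that by (simp add: k_def \<eta>_def max_def min_def)
  have k_0: "k t = 0" if "t \<notin> {a..b}" for t
    using that ab by (auto simp: k_def \<eta>_def max_def mult_le_0_iff zero_le_mult_iff)
  have ck: "continuous_on UNIV k"
    unfolding k_def using ab
    by (intro continuous_intros c\<eta> continuous_on_compose2[OF cu]) auto
  have "integral {a..b} k = J u"
    unfolding J_def by (rule integral_cong) (rule k_eq)
  moreover have "integral {a..b} (\<lambda>t. t * k t) = integral {a..b} (\<lambda>t. t * (\<eta> t * u t))"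
    by (rule integral_cong) (simp add: k_eq)
  ultimately have kab: "integral {a..b} k = 0" "integral {a..b} (\<lambda>t. t * k t) = 0"
    using u0 u1' by auto
  have "integral {0..l} (\<lambda>t. (f t - ((c0 - c1 * m) + c1 * t - t\<^sup>2 / 2)) * k t) = 0"
    by (rule weak_second_derivative_test[OF f w ck k_0 ab kab])
  then have "integral {0..l} (\<lambda>t. u t * k t) = 0"
    by (simp add: u_def F_def algebra_simps)
  moreover have "continuous_on {0..l} (\<lambda>t. u t * k t)"
    unfolding u_def F_def using ck by (auto intro!: continuous_intros f intro: continuous_on_subset)
  moreover have "0 \<le> u t * k t" for t
  proof (cases "t \<in> {a..b}")
    case True
    then have "u t * k t = \<eta> t * (u t)\<^sup>2"
      by (simp add: k_eq power2_eq_square)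
    then show ?thesis using \<eta>_nonneg[OF True] by simp
  qed (simp add: k_0)
  ultimately have "u t * k t = 0" if "t \<in> {0..l}" for t
    using that ab integral_nonneg_eq_0[of 0 l "\<lambda>t. u t * k t" t] by auto
  then have "u t = 0" if "a < t" "t < b" for t
  proof -
    have "u t * (\<eta> t * u t) = 0"
      using \<open>\<And>t. t \<in> {0..l} \<Longrightarrow> u t * k t = 0\<close>[of t] k_eq[of t] that ab by simp
    then show ?thesis using \<eta>0[OF that] by simp
  qed
  \<comment> \<open>At the ends \<eta> vanishes and gives no information, so continuity of u takes
    over.\<close>
  then have "u t = 0" if "t \<in> {a..b}" for t
    using that ab cu continuous_constant_on_closure[of "{a<..<b}" u 0 t] by auto
  then show ?thesis
    by (intro that[of "c0 - c1 * m" c1]) (auto simp: u_def F_def algebra_simps)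
qed

text \<open>The coefficients found on an inner interval might depend on it. The middle third serves
  as reference: an inner interval containing it and t yields an affine part that agrees at
  \<open>l/3\<close> and \<open>2*l/3\<close>, hence everywhere. The end points follow by
  continuity.\<close>

lemma weak_second_derivative_quadratic:
  fixes f :: "real \<Rightarrow> real"
  assumes f: "continuous_on {0..l} f" and w: "weak_second_derivative 0 l f (\<lambda>_. - 1)" and l: "0 < l"
  obtains \<alpha> \<beta> where "\<And>t. t \<in> {0..l} \<Longrightarrow> f t = \<alpha> + \<beta> * t - t\<^sup>2 / 2"
proof -
  obtain \<alpha> \<beta> where 1: "\<And>t. t \<in> {l/3..2*l/3} \<Longrightarrow> f t = \<alpha> + \<beta> * t - t\<^sup>2 / 2"
    using weak_second_derivative_inner[OF f w, of "l/3" "2*l/3"] l by auto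
  have 2: "f t - (\<alpha> + \<beta> * t - t\<^sup>2 / 2) = 0" if t: "t \<in> {0<..<l}" for t
  proof -
    have "0 < min t (l/3)" "min t (l/3) < max t (2*l/3)" "max t (2*l/3) < l"
      using l t by (auto simp: min_def max_def)
    then obtain \<alpha>' \<beta>' where 3: "\<And>s. s \<in> {min t (l/3)..max t (2*l/3)} \<Longrightarrow> f s = \<alpha>' + \<beta>' * s - s\<^sup>2 / 2"
      using weak_second_derivative_inner[OF f w, of "min t (l/3)" "max t (2*l/3)"] by blast
    have mem: "l/3 \<in> {l/3..2*l/3}" "2*l/3 \<in> {l/3..2*l/3}"
      "l/3 \<in> {min t (l/3)..max t (2*l/3)}" "2*l/3 \<in> {min t (l/3)..max t (2*l/3)}"
      using l by (simp_all add: min_def max_def)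
    have "\<alpha> + \<beta> * (l/3) = \<alpha>' + \<beta>' * (l/3)" "\<alpha> + \<beta> * (2*l/3) = \<alpha>' + \<beta>' * (2*l/3)"
      using 1[of "l/3"] 3[of "l/3"] 1[of "2*l/3"] 3[of "2*l/3"] mem by auto
    then have "\<beta> * l = \<beta>' * l" "\<alpha> = \<alpha>'"
      by linarith+
    then show ?thesis
      using 3[of t] l by auto
  qed
  have "continuous_on {0..l} (\<lambda>t. f t - (\<alpha> + \<beta> * t - t\<^sup>2 / 2))"
    by (intro continuous_intros f) auto
  then have "f t - (\<alpha> + \<beta> * t - t\<^sup>2 / 2) = 0" if "t \<in> {0..l}" for t
    using that l 2 continuous_constant_on_closure[of "{0<..<l}" "\<lambda>t. f t - (\<alpha> + \<beta> * t - t\<^sup>2 / 2)" 0 t]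
    by simp
  then show ?thesis
    using that by fastforce
qed

lemma quadratic_H2_on:
  fixes f :: "real \<Rightarrow> real"
  assumes "0 \<le> l" and f: "\<And>t. t \<in> {0..l} \<Longrightarrow> f t = \<alpha> + \<beta> * t - t\<^sup>2 / 2"
  shows "H2_on 0 l f" and "weak_second_derivative 0 l f (\<lambda>_. - 1)"
proof -
  define g where "g t = \<beta> - t" for t
  have "(f has_real_derivative g t) (at t within {0..l})" if "t \<in> {0..l}" for t
  proof (rule has_field_derivative_transform_within[OF _ zero_less_one that])
    show "((\<lambda>t. \<alpha> + \<beta> * t - t\<^sup>2 / 2) has_real_derivative g t) (at t within {0..l})"
      by (auto simp: g_def intro!: derivative_eq_intros)
  qed (use f in auto)
  moreover have cg: "continuous_on {0..l} g"
    unfolding g_def by (intro continuous_intros)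
  moreover have "(g has_real_derivative - 1) (at t within {0..l})" for t
    unfolding g_def by (auto intro!: derivative_eq_intros)
  ultimately have w: "weak_derivative 0 l f g" "weak_derivative 0 l g (\<lambda>_. - 1)"
    using \<open>0 \<le> l\<close> by (auto intro!: weak_derivative_classical)
  have "continuous_on {0..l} f"
    using f by (subst continuous_on_cong[OF refl f]) (auto intro!: continuous_intros)
  then have "L2_on 0 l f" "L2_on 0 l g" "L2_on 0 l (\<lambda>_. - 1)"
    using cg by (auto intro: L2_on_continuous)
  with w show "H2_on 0 l f" "weak_second_derivative 0 l f (\<lambda>_. - 1)"
    unfolding H2_on_def H1_on_def weak_second_derivative_def by blast+
qed

section \<open>Square linear systems\<close>

text \<open>Gaussian elimination by induction on the equations: a nonzero coefficient
  \<open>A i p\<close> solves the new equation for the unknown p, leaving one equation and one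
  unknown fewer. Index sets suit the later use, where the unknowns range over
  \<open>vertices G - D\<close>.\<close>

lemma underdetermined_kernel:
  fixes A :: "'i \<Rightarrow> 'j \<Rightarrow> real"
  assumes "finite I" "finite J" "card I < card J"
  obtains X where "\<And>i. i \<in> I \<Longrightarrow> (\<Sum>j\<in>J. A i j * X j) = 0" "\<exists>j\<in>J. X j \<noteq> 0"
proof -
  have "\<exists>X. (\<forall>i\<in>I. (\<Sum>j\<in>J. A i j * X j) = 0) \<and> (\<exists>j\<in>J. X j \<noteq> 0)"
    using assms
  proof (induction I arbitrary: J A rule: finite_induct)
    case empty
    then obtain j where "j \<in> J" by fastforce
    then show ?case by (intro exI[of _ "\<lambda>_. 1"]) auto
  next
    case (insert i I)
    show ?case
    proof (cases "\<exists>p\<in>J. A i p \<noteq> 0")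
      case False
      have "card I < card J" using insert.prems insert.hyps by simp
      from insert.IH[OF \<open>finite J\<close> this, of A] False show ?thesis by force
    next
      case True
      then obtain p where p: "p \<in> J" "A i p \<noteq> 0" by blast
      \<comment> \<open>Row k minus the multiple of row i that clears its entry in column p.\<close>
      define B where "B k j = A k j - A k p * A i j / A i p" for k j
      have "card I < card (J - {p})"
        using insert.prems insert.hyps p by simp
      from insert.IH[OF _ this, of B] insert.prems(1) obtain X where
        X: "\<And>k. k \<in> I \<Longrightarrow> (\<Sum>j\<in>J - {p}. B k j * X j) = 0" "\<exists>j\<in>J - {p}. X j \<noteq> 0"
        by auto
      define Y where "Y j = (if j = p then - (\<Sum>j\<in>J - {p}. A i j * X j) / A i p else X j)" for j
      have split: "(\<Sum>j\<in>J. A k j * Y j) =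
          (\<Sum>j\<in>J - {p}. A k j * X j) - A k p / A i p * (\<Sum>j\<in>J - {p}. A i j * X j)" for k
        using p(1) insert.prems(1) by (subst sum.remove[of _ p]) (auto simp: Y_def)
      have "(\<Sum>j\<in>J. A k j * Y j) = 0" if "k \<in> insert i I" for k
      proof (cases "k = i")
        case True then show ?thesis using split[of i] p by simp
      next
        case False
        then have "(\<Sum>j\<in>J - {p}. B k j * X j) = 0" using X that by simp
        moreover have "(\<Sum>j\<in>J - {p}. B k j * X j) =
            (\<Sum>j\<in>J - {p}. A k j * X j) - A k p / A i p * (\<Sum>j\<in>J - {p}. A i j * X j)"
          by (simp add: B_def left_diff_distrib sum_subtractf sum_distrib_left mult.assoc)
        ultimately show ?thesis by (simp add: split)
      qed
      moreover have "\<exists>j\<in>J. Y j \<noteq> 0"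
        using X(2) by (auto simp: Y_def)
      ultimately show ?thesis by blast
    qed
  qed
  then show ?thesis using that by blast
qed

text \<open>Homogenisation: the right-hand side becomes an extra column with unknown
  \<open>None\<close>, so a nonzero kernel vector exists. Injectivity makes its \<open>None\<close>
  entry nonzero, and dividing by that entry solves the system.\<close>

lemma square_system_solvable:
  fixes A :: "'i \<Rightarrow> 'i \<Rightarrow> real"
  assumes "finite I"
    and inj: "\<And>X. (\<And>i. i \<in> I \<Longrightarrow> (\<Sum>j\<in>I. A i j * X j) = 0) \<Longrightarrow> (\<And>i. i \<in> I \<Longrightarrow> X i = 0)"
  obtains X where "\<And>i. i \<in> I \<Longrightarrow> (\<Sum>j\<in>I. A i j * X j) = b i"
proof -
  define J where "J = insert None (Some ` I)"
  define B where "B i j = (case j of None \<Rightarrow> - b i | Some j' \<Rightarrow> A i j')" for i j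
  have "finite J" "card I < card J"
    using \<open>finite I\<close> by (auto simp: J_def card_image)
  then obtain Y where Y: "\<And>i. i \<in> I \<Longrightarrow> (\<Sum>j\<in>J. B i j * Y j) = 0" "\<exists>j\<in>J. Y j \<noteq> 0"
    using underdetermined_kernel[OF \<open>finite I\<close>] by metis
  have eq: "(\<Sum>j\<in>I. A i j * Y (Some j)) = b i * Y None" if "i \<in> I" for i
    using Y(1)[OF that] \<open>finite I\<close> by (simp add: J_def B_def sum.reindex)
  have "Y None \<noteq> 0"
  proof
    assume "Y None = 0"
    then have "Y (Some i) = 0" if "i \<in> I" for i
      using inj[of "\<lambda>i. Y (Some i)"] eq that by auto
    with Y(2) \<open>Y None = 0\<close> show False by (auto simp: J_def)
  qed
  then show ?thesis
    using eq by (intro that[of "\<lambda>j. Y (Some j) / Y None"])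
      (simp add: sum_divide_distrib[symmetric])
qed

section \<open>Superlevel sets of quadratics\<close>

text \<open>The general solution of \<open>- q'' = 1\<close>, with value \<alpha> and slope \<beta>
  at 0.\<close>

definition parab :: "real \<Rightarrow> real \<Rightarrow> real \<Rightarrow> real" where
  "parab \<alpha> \<beta> t = \<alpha> + \<beta> * t - t\<^sup>2 / 2"

text \<open>The critical point \<beta> clamped to \<open>{0..l}\<close>: for
  \<open>0 \<le> l\<close>, the maximiser of \<open>parab \<alpha> \<beta>\<close> on that
  interval.\<close>

definition apex :: "real \<Rightarrow> real \<Rightarrow> real" where
  "apex \<beta> l = max 0 (min l \<beta>)"

text \<open>The integral of the absolute value of the derivative of \<open>parab \<alpha> \<beta>\<close> over \<open>{0..l}\<close>.\<close>

definition parab_variation :: "real \<Rightarrow> real \<Rightarrow> real \<Rightarrow> real" where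
  "parab_variation \<alpha> \<beta> l = 2 * parab \<alpha> \<beta> (apex \<beta> l) - parab \<alpha> \<beta> 0 - parab \<alpha> \<beta> l"

lemma continuous_on_parab [continuous_intros]: "continuous_on S (parab \<alpha> \<beta>)"
  unfolding parab_def by (auto intro!: continuous_intros)

text \<open>The chord slope of a quadratic is its derivative at the midpoint; its sign gives the
  monotonicity on either side of the apex.\<close>

lemma parab_diff: "parab \<alpha> \<beta> s - parab \<alpha> \<beta> r = (s - r) * (\<beta> - (s + r) / 2)"
  by (simp add: parab_def field_simps power2_eq_square)

lemma parab_0: "parab \<alpha> \<beta> 0 = \<alpha>"
  by (simp add: parab_def)

lemma apex_bounds: "0 \<le> l \<Longrightarrow> apex \<beta> l \<in> {0..l}"
  by (auto simp: apex_def)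

lemma parab_increasing:
  assumes "0 \<le> r" "r < s" "s \<le> apex \<beta> l"
  shows "parab \<alpha> \<beta> r < parab \<alpha> \<beta> s"
proof -
  have "s \<le> \<beta>" using assms by (auto simp: apex_def max_def split: if_splits)
  then have "0 < (s - r) * (\<beta> - (s + r) / 2)"
    using assms by (intro mult_pos_pos) auto
  then show ?thesis using parab_diff[of \<alpha> \<beta> s r] by simp
qed

lemma parab_decreasing:
  assumes "apex \<beta> l \<le> r" "r < s" "s \<le> l"
  shows "parab \<alpha> \<beta> s < parab \<alpha> \<beta> r"
proof -
  have "\<beta> \<le> r" using assms by (auto simp: apex_def max_def min_def split: if_splits)
  then have "(s - r) * (\<beta> - (s + r) / 2) < 0"
    using assms by (intro mult_pos_neg) auto
  then show ?thesis using parab_diff[of \<alpha> \<beta> s r] by simp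
qed

lemma parab_le_apex:
  assumes "s \<in> {0..l}"
  shows "parab \<alpha> \<beta> s \<le> parab \<alpha> \<beta> (apex \<beta> l)"
proof (cases "s = apex \<beta> l")
  case False
  then show ?thesis
    using assms parab_increasing[of s "apex \<beta> l" \<beta> l \<alpha>] parab_decreasing[of \<beta> l "apex \<beta> l" s \<alpha>] by force
qed simp

lemma card_le_indicator:
  assumes "\<And>x y. x \<in> S \<Longrightarrow> y \<in> S \<Longrightarrow> x = y" "\<And>x. x \<in> S \<Longrightarrow> t \<in> T"
  shows "finite S \<and> real (card S) \<le> indicator T t"
proof -
  have "S = {} \<or> (\<exists>x. S = {x})" using assms(1) by blast
  then show ?thesis using assms(2) by auto
qed

text \<open>Each of the two monotone branches meets a level at most once. The bound is chosen so
  that its integral over t is \<open>parab_variation \<alpha> \<beta> l\<close>, which makes it the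
  coarea formula as an inequality; counting the apex in both branches is harmless.\<close>

lemma card_parab_level:
  assumes "0 \<le> l"
  shows "finite {s \<in> {0..l}. parab \<alpha> \<beta> s = t}"
    and "real (card {s \<in> {0..l}. parab \<alpha> \<beta> s = t}) \<le>
      indicator {parab \<alpha> \<beta> 0..parab \<alpha> \<beta> (apex \<beta> l)} t + indicator {parab \<alpha> \<beta> l..parab \<alpha> \<beta> (apex \<beta> l)} t"
proof -
  let ?q = "parab \<alpha> \<beta>" and ?m = "apex \<beta> l"
  let ?L = "{s \<in> {0..?m}. ?q s = t}" and ?R = "{s \<in> {?m..l}. ?q s = t}"
  have m: "0 \<le> ?m" "?m \<le> l" using apex_bounds[OF assms, of \<beta>] by auto
  have lr: "{s \<in> {0..l}. ?q s = t} = ?L \<union> ?R" using m by auto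
  have L: "finite ?L \<and> real (card ?L) \<le> indicator {?q 0..?q ?m} t"
  proof (rule card_le_indicator)
    fix x y assume "x \<in> ?L" "y \<in> ?L"
    then show "x = y"
      using parab_increasing[of x y \<beta> l \<alpha>] parab_increasing[of y x \<beta> l \<alpha>]
      by (cases x y rule: linorder_cases) auto
  next
    fix x assume "x \<in> ?L"
    then show "t \<in> {?q 0..?q ?m}"
      using parab_increasing[of 0 x \<beta> l \<alpha>] parab_increasing[of x ?m \<beta> l \<alpha>]
      by (cases "x = 0"; cases "x = ?m") auto
  qed
  have R: "finite ?R \<and> real (card ?R) \<le> indicator {?q l..?q ?m} t"
  proof (rule card_le_indicator)
    fix x y assume "x \<in> ?R" "y \<in> ?R"
    then show "x = y"
      using parab_decreasing[of \<beta> l x y \<alpha>] parab_decreasing[of \<beta> l y x \<alpha>]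
      by (cases x y rule: linorder_cases) auto
  next
    fix x assume "x \<in> ?R"
    then show "t \<in> {?q l..?q ?m}"
      using parab_decreasing[of \<beta> l ?m x \<alpha>] parab_decreasing[of \<beta> l x l \<alpha>]
      by (cases "x = l"; cases "x = ?m") auto
  qed
  show "finite {s \<in> {0..l}. ?q s = t}" unfolding lr using L R by simp
  show "real (card {s \<in> {0..l}. ?q s = t}) \<le> indicator {?q 0..?q ?m} t + indicator {?q l..?q ?m} t"
    unfolding lr using L R card_Un_le[of ?L ?R] by linarith
qed

text \<open>Completing the square turns the superlevel set into a closed ball about \<beta>, cut
  down to \<open>{0..l}\<close>. Because t lies strictly below the maximum, the apex is interior to
  the ball, so the cut interval is non-degenerate, as the notion of subgraph demands.\<close>

lemma parab_superlevel:
  assumes "0 < l" "t < parab \<alpha> \<beta> (apex \<beta> l)"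
  obtains a b where "0 \<le> a" "a < b" "b \<le> l" "{s \<in> {0..l}. t \<le> parab \<alpha> \<beta> s} = {a..b}"
proof -
  define K where "K = 2 * (\<alpha> - t) + \<beta>\<^sup>2"
  define r where "r = sqrt K"
  have q: "2 * (parab \<alpha> \<beta> s - t) = K - (s - \<beta>)\<^sup>2" for s
    by (simp add: parab_def K_def power2_eq_square algebra_simps)
  \<comment> \<open>\<open>sqrt\<close> is strictly increasing on all reals, so the equivalence also
    covers negative \<open>K\<close>.\<close>
  have iff: "t \<le> parab \<alpha> \<beta> s \<longleftrightarrow> \<bar>s - \<beta>\<bar> \<le> r" for s
  proof -
    have "t \<le> parab \<alpha> \<beta> s \<longleftrightarrow> (s - \<beta>)\<^sup>2 \<le> K" using q[of s] by (smt (verit))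
    then show ?thesis by (simp add: r_def real_sqrt_abs[symmetric] del: real_sqrt_abs)
  qed
  have "(apex \<beta> l - \<beta>)\<^sup>2 < K" using q[of "apex \<beta> l"] assms(2) by simp
  then have "\<bar>apex \<beta> l - \<beta>\<bar> < r"
    by (simp add: r_def real_sqrt_abs[symmetric] del: real_sqrt_abs)
  then show ?thesis
    using assms(1) apex_bounds[of l \<beta>]
    by (intro that[of "max 0 (\<beta> - r)" "min l (\<beta> + r)"]) (auto simp: iff)
qed

text \<open>The difference of the two sides is \<open>\<integral> (\<bar>q'\<bar> - c)\<^sup>2\<close> over \<open>{0..l}\<close>, split at the apex; it is positive
  because \<open>q'\<close> is not locally constant.\<close>

lemma parab_variation_AM_GM:
  assumes "0 < l"
  shows "2 * c * parab_variation \<alpha> \<beta> l < (\<beta> ^ 3 - (\<beta> - l) ^ 3) / 3 + c\<^sup>2 * l"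
proof -
  let ?m = "apex \<beta> l"
  have m: "0 \<le> ?m" "?m \<le> l" using apex_bounds[of l \<beta>] assms by auto
  have mono: "x ^ 3 < y ^ 3" if "x < y" for x y :: real
  proof -
    have "0 < (x + y)\<^sup>2 + (x\<^sup>2 + y\<^sup>2)"
      using that sum_power2_gt_zero_iff[of x y] zero_le_power2[of "x + y"] by linarith
    then have "0 < (y - x) * ((x + y)\<^sup>2 + (x\<^sup>2 + y\<^sup>2))"
      using that by simp
    also have "\<dots> = 2 * (y ^ 3 - x ^ 3)"
      by (simp add: power2_eq_square power3_eq_cube algebra_simps)
    finally show ?thesis by simp
  qed
  \<comment> \<open>Three times the integral of \<open>(\<bar>q'\<bar> - c)\<^sup>2\<close>: the
    derivative has absolute value \<open>\<beta> - s\<close> left of the apex and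
    \<open>s - \<beta>\<close> right of it. At least one of the two pieces has positive length and
    contributes strictly.\<close>
  have "0 < (\<beta> - c) ^ 3 - (\<beta> - c - ?m) ^ 3 + ((l - \<beta> - c) ^ 3 - (?m - \<beta> - c) ^ 3)"
  proof (cases "0 < ?m")
    case True
    have "(?m - \<beta> - c) ^ 3 \<le> (l - \<beta> - c) ^ 3" using m by (intro power_mono_odd) auto
    with True mono[of "\<beta> - c - ?m" "\<beta> - c"] show ?thesis by simp
  next
    case False
    with m assms mono[of "?m - \<beta> - c" "l - \<beta> - c"] show ?thesis by simp
  qed
  also have "\<dots> = 3 * ((\<beta> ^ 3 - (\<beta> - l) ^ 3) / 3 + c\<^sup>2 * l - 2 * c * parab_variation \<alpha> \<beta> l)"
    unfolding parab_variation_def parab_def by (simp add: power2_eq_square power3_eq_cube field_simps)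
  finally show ?thesis by (simp only: zero_less_mult_iff) simp
qed

section \<open>Integrals of quadratics and integration over levels\<close>

lemma has_integral_parab:
  assumes "0 \<le> l"
  shows "(parab \<alpha> \<beta> has_integral \<alpha> * l + \<beta> * l\<^sup>2 / 2 - l ^ 3 / 6) {0..l}"
proof -
  have "(parab \<alpha> \<beta> has_integral
      (\<alpha> * l + \<beta> * l\<^sup>2 / 2 - l ^ 3 / 6) - (\<alpha> * 0 + \<beta> * 0\<^sup>2 / 2 - 0 ^ 3 / 6)) {0..l}"
    using assms by (intro fundamental_theorem_of_calculus)
      (auto simp: has_real_derivative_iff_has_vector_derivative[symmetric] parab_def
        intro!: derivative_eq_intros)
  then show ?thesis by simp
qed

text \<open>Integration by parts of \<open>q'\<^sup>2\<close> with \<open>q'' = - 1\<close>; the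
  right-hand side is the integral of \<open>(\<beta> - s)\<^sup>2\<close> over
  \<open>{0..l}\<close>.\<close>

lemma parab_energy:
  assumes "0 \<le> l"
  shows "parab \<alpha> \<beta> l * (\<beta> - l) - parab \<alpha> \<beta> 0 * \<beta> + integral {0..l} (parab \<alpha> \<beta>) =
    (\<beta> ^ 3 - (\<beta> - l) ^ 3) / 3"
  unfolding integral_unique[OF has_integral_parab[OF assms]]
  by (simp add: parab_def power2_eq_square power3_eq_cube field_simps)

text \<open>Tonelli on the region \<open>0 < t \<le> q s\<close>. The double integral equals the
  integral of \<open>max 0 (q s)\<close>, whence an inequality for q of arbitrary sign.\<close>

lemma layer_cake_le:
  fixes q :: "real \<Rightarrow> real"
  assumes "continuous_on UNIV q"
  shows "(\<lambda>t. indicator {0<..} t * ennreal (measure lborel {s \<in> {0..l}. t \<le> q s})) \<in> borel_measurable lborel"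
    and "ennreal (integral {0..l} q) \<le>
      (\<integral>\<^sup>+t. indicator {0<..} t * ennreal (measure lborel {s \<in> {0..l}. t \<le> q s}) \<partial>lborel)"
proof -
  have [measurable]: "q \<in> borel_measurable borel"
    using assms by (rule borel_measurable_continuous_onI)
  \<comment> \<open>\<open>measure\<close> returns 0 on sets of infinite measure, so finiteness has
    to come before it can replace \<open>emeasure\<close>.\<close>
  have "emeasure lborel {s \<in> {0..l}. t \<le> q s} \<le> emeasure lborel {0..l}" for t
    by (intro emeasure_mono) auto
  also have "emeasure lborel {0..l} < \<infinity>" by (simp add: emeasure_lborel_Icc_eq)
  finally have "emeasure lborel {s \<in> {0..l}. t \<le> q s} = ennreal (measure lborel {s \<in> {0..l}. t \<le> q s})" for t
    by (intro emeasure_eq_ennreal_measure) (metis infinity_ennreal_def less_irrefl)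
  moreover have "emeasure lborel {s \<in> {0..l}. t \<le> q s} = (\<integral>\<^sup>+s. indicator {s \<in> {0..l}. t \<le> q s} s \<partial>lborel)" for t
    by (subst nn_integral_indicator) auto
  moreover have "indicator {0<..} t * (\<integral>\<^sup>+s. indicator {s \<in> {0..l}. t \<le> q s} s \<partial>lborel) =
      (\<integral>\<^sup>+s. indicator {0<..} t * indicator {s \<in> {0..l}. t \<le> q s} s \<partial>lborel)" for t :: real
    by (subst nn_integral_cmult) auto
  ultimately have eq: "indicator {0<..} t * ennreal (measure lborel {s \<in> {0..l}. t \<le> q s}) =
      (\<integral>\<^sup>+s. indicator {0<..} t * indicator {s \<in> {0..l}. t \<le> q s} s \<partial>lborel)" for t :: real
    by metis
  let ?f = "\<lambda>t s. indicator {0<..} t * indicator {s \<in> {0..l}. t \<le> q s} s :: ennreal"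
  have f_eq: "case_prod ?f = indicator {x \<in> space (lborel \<Otimes>\<^sub>M lborel).
      0 < fst x \<and> 0 \<le> snd x \<and> snd x \<le> l \<and> fst x \<le> q (snd x)}"
    by (auto simp: fun_eq_iff space_pair_measure indicator_def)
  have "{x \<in> space (lborel \<Otimes>\<^sub>M lborel).
      0 < fst x \<and> 0 \<le> snd x \<and> snd x \<le> l \<and> fst x \<le> q (snd x)} \<in> sets (lborel \<Otimes>\<^sub>M lborel)"
    by measurable
  then have meas: "case_prod ?f \<in> borel_measurable (lborel \<Otimes>\<^sub>M lborel)"
    unfolding f_eq by (rule borel_measurable_indicator)
  show "(\<lambda>t. indicator {0<..} t * ennreal (measure lborel {s \<in> {0..l}. t \<le> q s})) \<in> borel_measurable lborel"
    unfolding eq by (rule lborel.borel_measurable_nn_integral[OF meas])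
  have "(\<integral>\<^sup>+t. indicator {0<..} t * ennreal (measure lborel {s \<in> {0..l}. t \<le> q s}) \<partial>lborel) =
      (\<integral>\<^sup>+s. (\<integral>\<^sup>+t. ?f t s \<partial>lborel) \<partial>lborel)"
    unfolding eq by (rule lborel_pair.Fubini'[OF meas, symmetric])
  also have "\<dots> = (\<integral>\<^sup>+s. ennreal (indicator {0..l} s * max 0 (q s)) \<partial>lborel)"
  proof (rule nn_integral_cong)
    fix s
    have "?f t s = indicator {0..l} s * indicator {0<..q s} t" for t
      by (auto split: split_indicator)
    then have "(\<integral>\<^sup>+t. ?f t s \<partial>lborel) = (\<integral>\<^sup>+t. indicator {0..l} s * indicator {0<..q s} t \<partial>lborel)"
      by simp
    also have "\<dots> = indicator {0..l} s * emeasure lborel {0<..q s}"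
      by (simp add: nn_integral_cmult)
    also have "\<dots> = ennreal (indicator {0..l} s * max 0 (q s))"
      by (cases "0 \<le> q s") (auto split: split_indicator)
    finally show "(\<integral>\<^sup>+t. ?f t s \<partial>lborel) = ennreal (indicator {0..l} s * max 0 (q s))" .
  qed
  also have "\<dots> = ennreal (integral {0..l} (\<lambda>s. max 0 (q s)))"
  proof (rule nn_integral_has_integral_lebesgue)
    show "((\<lambda>s. max 0 (q s)) has_integral integral {0..l} (\<lambda>s. max 0 (q s))) {0..l}"
      using assms by (intro integrable_integral integrable_continuous_real continuous_intros)
         (auto intro: continuous_on_subset)
  qed auto
  also have "ennreal (integral {0..l} q) \<le> \<dots>"
    using assms by (intro ennreal_leI integral_le integrable_continuous_real continuous_intros)
      (auto intro: continuous_on_subset)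
  finally show "ennreal (integral {0..l} q) \<le>
      (\<integral>\<^sup>+t. indicator {0<..} t * ennreal (measure lborel {s \<in> {0..l}. t \<le> q s}) \<partial>lborel)" .
qed

text \<open>\<open>ennreal\<close> sends negative reals to 0, so negative terms can lower only the
  left side. The integrals of the torsion function over single edges come without a known
  sign.\<close>

lemma ennreal_sum_le: "ennreal (sum f A) \<le> (\<Sum>x\<in>A. ennreal (f x))"
proof -
  have "ennreal (sum f A) \<le> ennreal (\<Sum>x\<in>A. max 0 (f x))"
    by (intro ennreal_leI sum_mono) auto
  also have "\<dots> = (\<Sum>x\<in>A. ennreal (max 0 (f x)))"
    by (rule sum_ennreal[symmetric]) auto
  also have "\<dots> = (\<Sum>x\<in>A. ennreal (f x))"
    by (simp add: ennreal_max_0)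
  finally show ?thesis .
qed

text \<open>Layer-cake formula on the left, coarea formula on the right.\<close>

lemma isoperimetric_integral_le:
  fixes \<alpha> \<beta> l :: "'e \<Rightarrow> real"
  assumes "\<And>e. e \<in> E \<Longrightarrow> 0 \<le> l e" "0 \<le> h" "finite F"
    and main: "\<And>t. 0 < t \<Longrightarrow> t \<notin> F \<Longrightarrow>
      h * (\<Sum>e\<in>E. measure lborel {s \<in> {0..l e}. t \<le> parab (\<alpha> e) (\<beta> e) s}) \<le>
      (\<Sum>e\<in>E. real (card {s \<in> {0..l e}. parab (\<alpha> e) (\<beta> e) s = t}))"
  shows "h * (\<Sum>e\<in>E. integral {0..l e} (parab (\<alpha> e) (\<beta> e))) \<le>
    (\<Sum>e\<in>E. parab_variation (\<alpha> e) (\<beta> e) (l e))"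
proof -
  let ?q = "\<lambda>e. parab (\<alpha> e) (\<beta> e)"
  let ?Q = "\<lambda>e. ?q e (apex (\<beta> e) (l e))"
  let ?m = "\<lambda>e t. measure lborel {s \<in> {0..l e}. t \<le> ?q e s}"
  let ?J = "\<lambda>e t. indicator {?q e 0..?Q e} t + indicator {?q e (l e)..?Q e} t"
  have le: "?q e 0 \<le> ?Q e" "?q e (l e) \<le> ?Q e" if "e \<in> E" for e
    using assms(1)[OF that] by (auto intro: parab_le_apex)
  then have v: "0 \<le> parab_variation (\<alpha> e) (\<beta> e) (l e)" if "e \<in> E" for e
    using that unfolding parab_variation_def by force
  note lc = layer_cake_le[OF continuous_on_parab]
  have "ennreal (h * (\<Sum>e\<in>E. integral {0..l e} (?q e))) =
      ennreal h * ennreal (\<Sum>e\<in>E. integral {0..l e} (?q e))"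
    using \<open>0 \<le> h\<close> by (rule ennreal_mult')
  also have "\<dots> \<le> ennreal h * (\<Sum>e\<in>E. \<integral>\<^sup>+t. indicator {0<..} t * ennreal (?m e t) \<partial>lborel)"
    by (intro mult_left_mono order_trans[OF ennreal_sum_le] sum_mono lc(2)) auto
  also have "\<dots> = (\<integral>\<^sup>+t. ennreal h * (\<Sum>e\<in>E. indicator {0<..} t * ennreal (?m e t)) \<partial>lborel)"
    using lc(1) by (simp add: nn_integral_sum nn_integral_cmult)
  also have "\<dots> \<le> (\<integral>\<^sup>+t. (\<Sum>e\<in>E. ennreal (?J e t)) \<partial>lborel)"
  proof (rule nn_integral_mono_AE)
    \<comment> \<open>The exceptional levels form a null set, so the hypothesis is available for
      almost every positive level; for other t the left integrand is 0.\<close>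
    have "AE t in lborel. t \<notin> F"
      using \<open>finite F\<close> by (intro AE_not_in finite_imp_null_set_lborel)
    then show "AE t in lborel. ennreal h * (\<Sum>e\<in>E. indicator {0<..} t * ennreal (?m e t)) \<le>
        (\<Sum>e\<in>E. ennreal (?J e t))"
    proof eventually_elim
      case (elim t)
      show ?case
      proof (cases "0 < t")
        case True
        have "ennreal h * (\<Sum>e\<in>E. ennreal (?m e t)) = ennreal (h * (\<Sum>e\<in>E. ?m e t))"
          using \<open>0 \<le> h\<close> by (simp add: ennreal_mult sum_nonneg sum_ennreal)
        also have "\<dots> \<le> ennreal (\<Sum>e\<in>E. ?J e t)"
          using assms(1)
          by (intro ennreal_leI order_trans[OF main[OF True elim]] sum_mono card_parab_level(2))
        also have "\<dots> = (\<Sum>e\<in>E. ennreal (?J e t))"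
          by (rule sum_ennreal[symmetric]) auto
        finally show ?thesis using True by simp
      qed simp
    qed
  qed
  also have "\<dots> = (\<Sum>e\<in>E. \<integral>\<^sup>+t. ennreal (?J e t) \<partial>lborel)"
    by (rule nn_integral_sum) auto
  \<comment> \<open>Each indicator integrates to the length of its interval, and the two lengths are
    the rise to the apex and the fall from it.\<close>
  also have "\<dots> = (\<Sum>e\<in>E. ennreal (parab_variation (\<alpha> e) (\<beta> e) (l e)))"
  proof (rule sum.cong)
    fix e assume "e \<in> E"
    have "(\<integral>\<^sup>+t. ennreal (?J e t) \<partial>lborel) =
        (\<integral>\<^sup>+t. indicator {?q e 0..?Q e} t + indicator {?q e (l e)..?Q e} t \<partial>lborel)"
      by (intro nn_integral_cong) (auto split: split_indicator simp flip: ennreal_numeral)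
    also have "\<dots> = ennreal (?Q e - ?q e 0) + ennreal (?Q e - ?q e (l e))"
      using le[OF \<open>e \<in> E\<close>] by (subst nn_integral_add) auto
    also have "\<dots> = ennreal (parab_variation (\<alpha> e) (\<beta> e) (l e))"
      using le[OF \<open>e \<in> E\<close>] by (simp add: parab_variation_def flip: ennreal_plus)
    finally show "(\<integral>\<^sup>+t. ennreal (?J e t) \<partial>lborel) = ennreal (parab_variation (\<alpha> e) (\<beta> e) (l e))" .
  qed simp
  also have "\<dots> = ennreal (\<Sum>e\<in>E. parab_variation (\<alpha> e) (\<beta> e) (l e))"
    using v by (rule sum_ennreal)
  finally show ?thesis
    using v by (simp add: ennreal_le_iff sum_nonneg)
qed

section \<open>Existence and uniqueness of the torsion function\<close>

text \<open>The slope at 0 of the solution with end values given by X: the chord slope plus a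
  half-length that compensates the curvature.\<close>

definition edge_slope :: "('v, 'e) metric_graph \<Rightarrow> ('v \<Rightarrow> real) \<Rightarrow> 'e \<Rightarrow> real" where
  "edge_slope G X e = (X (tgt G e) - X (src G e)) / len G e + len G e / 2"

definition torsion_extension ::
  "('v, 'e) metric_graph \<Rightarrow> ('v \<Rightarrow> real) \<Rightarrow> ('v, 'e) point \<Rightarrow> real" where
  "torsion_extension G X = restrict (\<lambda>p. case p of Vertex x \<Rightarrow> X x
     | Inner e t \<Rightarrow> parab (X (src G e)) (edge_slope G X e) t) (points G)"

text \<open>Common form of the normal derivative sum and the discrete Laplacian; a loop enters both
  sums, once for each of its ends.\<close>

definition vertex_sum ::
  "('v, 'e) metric_graph \<Rightarrow> ('e \<Rightarrow> real) \<Rightarrow> ('e \<Rightarrow> real) \<Rightarrow> 'v \<Rightarrow> real" where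
  "vertex_sum G a b x =
     (\<Sum>e | e \<in> edges G \<and> src G e = x. a e) + (\<Sum>e | e \<in> edges G \<and> tgt G e = x. b e)"

text \<open>The weighted graph Laplacian with conductance \<open>1 / len G e\<close>, signed so as
  to be negative semidefinite.\<close>

definition graph_laplacian :: "('v, 'e) metric_graph \<Rightarrow> ('v \<Rightarrow> real) \<Rightarrow> 'v \<Rightarrow> real" where
  "graph_laplacian G X = vertex_sum G (\<lambda>e. (X (tgt G e) - X (src G e)) / len G e)
     (\<lambda>e. (X (src G e) - X (tgt G e)) / len G e)"

text \<open>Discrete summation by parts: every edge end belongs to exactly one vertex, so sums over
  vertices regroup by edges.\<close>

lemma sum_vertices_vertex_sum:
  assumes "finite (edges G)"
  shows "(\<Sum>x\<in>vertices G. X x * vertex_sum G a b x) =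
    (\<Sum>e\<in>edges G. X (src G e) * a e + X (tgt G e) * b e)"
proof -
  have fin: "finite (vertices G)" using assms by (simp add: vertices_def)
  have *: "(\<Sum>x\<in>vertices G. X x * (\<Sum>e | e \<in> edges G \<and> f e = x. c e)) = (\<Sum>e\<in>edges G. X (f e) * c e)"
    if "f ` edges G \<subseteq> vertices G" for f c
    using sum.group[OF assms fin that, of "\<lambda>e. X (f e) * c e"] by (simp add: sum_distrib_left)
  have "src G ` edges G \<subseteq> vertices G" "tgt G ` edges G \<subseteq> vertices G"
    by (auto simp: vertices_def)
  then show ?thesis
    by (simp add: vertex_sum_def distrib_left sum.distrib *)
qed

section \<open>Points of the graph and reduction to vertex values\<close>

lemma edge_point_in_points: "e \<in> edges G \<Longrightarrow> t \<in> {0..len G e} \<Longrightarrow> edge_point G e t \<in> points G"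
  unfolding points_def by blast

lemma pointsE:
  assumes "p \<in> points G"
  obtains e t where "e \<in> edges G" "t \<in> {0..len G e}" "p = edge_point G e t"
  using assms by (auto simp: points_def)

lemma vertex_in_points:
  assumes "\<And>e. e \<in> edges G \<Longrightarrow> 0 < len G e"
  shows "Vertex x \<in> points G \<longleftrightarrow> x \<in> vertices G"
proof
  assume "Vertex x \<in> points G"
  then show "x \<in> vertices G"
    by (elim pointsE) (auto simp: edge_point_def vertices_def split: if_splits)
next
  assume "x \<in> vertices G"
  then obtain e where e: "e \<in> edges G" "x = src G e \<or> x = tgt G e" by (auto simp: vertices_def)
  then have "Vertex x = edge_point G e 0 \<or> Vertex x = edge_point G e (len G e)"
    using assms[OF e(1)] by (auto simp: edge_point_def)
  then show "Vertex x \<in> points G"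
    using edge_point_in_points[OF e(1), of 0] edge_point_in_points[OF e(1), of "len G e"] assms[OF e(1)]
    by auto
qed

lemma parab_edge_slope_len:
  "0 < len G e \<Longrightarrow> parab (X (src G e)) (edge_slope G X e) (len G e) = X (tgt G e)"
  by (simp add: parab_def edge_slope_def field_simps power2_eq_square)

lemma on_edge_torsion_extension:
  assumes "e \<in> edges G" "0 < len G e" "t \<in> {0..len G e}"
  shows "on_edge G (torsion_extension G X) e t = parab (X (src G e)) (edge_slope G X e) t"
  using edge_point_in_points[OF assms(1,3)] parab_edge_slope_len[OF assms(2), of X]
  by (auto simp: on_edge_def torsion_extension_def edge_point_def parab_def)

text \<open>The universal property of the quotient topology.\<close>

lemma continuous_map_graph_topology:
  "continuous_map (graph_topology G) euclideanreal v \<longleftrightarrow>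
    (\<forall>e\<in>edges G. continuous_on {0..len G e} (on_edge G v e))"
proof -
  have "{t \<in> {0..len G e}. edge_point G e t \<in> {p \<in> points G. v p \<in> U}} =
      {t \<in> {0..len G e}. on_edge G v e t \<in> U}" if "e \<in> edges G" for e U
    using edge_point_in_points[OF that] by (auto simp: on_edge_def)
  then show ?thesis
    unfolding continuous_map_iff_continuous[symmetric] continuous_map_def
      topspace_graph_topology openin_graph_topology
    by auto
qed

text \<open>The derivative at s is \<open>edge_slope G X e - s\<close>. Pointing into the edge, it
  keeps its sign at the source and changes it at the target.\<close>

lemma normal_derivative_sum_parab:
  assumes pos: "\<And>e. e \<in> edges G \<Longrightarrow> 0 < len G e"
    and v: "\<And>e t. e \<in> edges G \<Longrightarrow> t \<in> {0..len G e} \<Longrightarrow>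
      on_edge G v e t = parab (X (src G e)) (edge_slope G X e) t"
  shows "normal_derivative_sum G v x =
    vertex_sum G (edge_slope G X) (\<lambda>e. len G e - edge_slope G X e) x"
proof -
  have "vector_derivative (on_edge G v e) (at s within {0..len G e}) = edge_slope G X e - s"
    if e: "e \<in> edges G" and s: "s \<in> {0..len G e}" for e s
  proof (rule vector_derivative_within_closed_interval[OF pos[OF e] s])
    show "(on_edge G v e has_vector_derivative edge_slope G X e - s) (at s within {0..len G e})"
    proof (rule has_vector_derivative_transform[OF s])
      show "(parab (X (src G e)) (edge_slope G X e) has_vector_derivative edge_slope G X e - s)
          (at s within {0..len G e})"
        unfolding parab_def has_real_derivative_iff_has_vector_derivative[symmetric]
        by (auto intro!: derivative_eq_intros)
    qed (use v e in auto)
  qed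
  then show ?thesis
    unfolding normal_derivative_sum_def vertex_sum_def using pos
    by (intro arg_cong2[of _ _ _ _ "(+)"] sum.cong) (auto simp: less_imp_le)
qed

text \<open>Regularity of weak solutions makes a torsion function recoverable from its vertex
  values, so uniqueness becomes a question about finitely many numbers.\<close>

lemma torsion_function_shape:
  assumes pos: "\<And>e. e \<in> edges G \<Longrightarrow> 0 < len G e" and v: "is_torsion_function G D v"
  shows "v = torsion_extension G (\<lambda>x. v (Vertex x))"
proof
  let ?X = "\<lambda>x. v (Vertex x)"
  fix p
  show "v p = torsion_extension G ?X p"
  proof (cases "p \<in> points G")
    case True
    then obtain e t where e: "e \<in> edges G" and t: "t \<in> {0..len G e}" and p: "p = edge_point G e t"
      by (rule pointsE)
    have "continuous_on {0..len G e} (on_edge G v e)"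
      "weak_second_derivative 0 (len G e) (on_edge G v e) (\<lambda>_. - 1)"
      using v e unfolding is_torsion_function_def continuous_map_graph_topology by auto
    from weak_second_derivative_quadratic[OF this pos[OF e]] obtain \<alpha> \<beta> where
      q: "\<And>t. t \<in> {0..len G e} \<Longrightarrow> on_edge G v e t = \<alpha> + \<beta> * t - t\<^sup>2 / 2" by blast
    have "\<alpha> = ?X (src G e)"
      using q[of 0] pos[OF e] by (simp add: on_edge_def edge_point_def)
    moreover have "\<beta> = edge_slope G ?X e"
      using q[of "len G e"] pos[OF e] \<open>\<alpha> = _\<close>
      by (simp add: on_edge_def edge_point_def edge_slope_def field_simps power2_eq_square)
    ultimately have "on_edge G v e t = on_edge G (torsion_extension G ?X) e t"
      using q[OF t] on_edge_torsion_extension[OF e pos[OF e] t, of ?X] by (simp add: parab_def)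
    then show ?thesis by (simp add: on_edge_def p)
  next
    case False
    then show ?thesis
      using v by (simp add: is_torsion_function_def torsion_extension_def extensional_def)
  qed
qed

text \<open>Continuity and the differential equation are built into the extension; what remains is
  the linear system of Dirichlet and Kirchhoff conditions.\<close>

lemma is_torsion_function_torsion_extension:
  assumes pos: "\<And>e. e \<in> edges G \<Longrightarrow> 0 < len G e" and "D \<subseteq> vertices G"
  shows "is_torsion_function G D (torsion_extension G X) \<longleftrightarrow> (\<forall>x\<in>D. X x = 0) \<and>
    (\<forall>x\<in>vertices G - D. vertex_sum G (edge_slope G X) (\<lambda>e. len G e - edge_slope G X e) x = 0)"
proof -
  let ?v = "torsion_extension G X"
  have on: "on_edge G ?v e t = parab (X (src G e)) (edge_slope G X e) t"
    if "e \<in> edges G" "t \<in> {0..len G e}" for e t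
    using that(1) pos[OF that(1)] that(2) by (rule on_edge_torsion_extension)
  have "continuous_on {0..len G e} (on_edge G ?v e)" if e: "e \<in> edges G" for e
    by (rule continuous_on_eq[OF continuous_on_parab]) (use on[OF e] in simp)
  moreover have "H2_on 0 (len G e) (on_edge G ?v e) \<and>
      weak_second_derivative 0 (len G e) (on_edge G ?v e) (\<lambda>_. - 1)" if e: "e \<in> edges G" for e
    using quadratic_H2_on[OF less_imp_le[OF pos[OF e]], of "on_edge G ?v e" "X (src G e)" "edge_slope G X e"]
      on[OF e] by (simp add: parab_def)
  moreover have "?v (Vertex x) = X x" if "x \<in> D" for x
    using that vertex_in_points[OF pos] \<open>D \<subseteq> vertices G\<close> by (auto simp: torsion_extension_def)
  moreover have "normal_derivative_sum G ?v x =
      vertex_sum G (edge_slope G X) (\<lambda>e. len G e - edge_slope G X e) x" for x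
    using pos on by (rule normal_derivative_sum_parab)
  moreover have "?v \<in> extensional (points G)"
    by (simp add: torsion_extension_def)
  ultimately show ?thesis
    unfolding is_torsion_function_def continuous_map_graph_topology by simp
qed

text \<open>Connectedness is given topologically, so Z is extended to a function on all points that
  is constant on every edge. The preimage of any set then meets each edge in everything or nothing
  and is open; thus the zero set and its complement would disconnect the graph.\<close>

lemma constant_along_edges_zero:
  assumes G: "compact_connected_graph G" and "x0 \<in> vertices G" "Z x0 = 0"
    and edge: "\<And>e. e \<in> edges G \<Longrightarrow> Z (tgt G e) = (Z (src G e) :: real)" and "x \<in> vertices G"
  shows "Z x = 0"
proof -
  have pos: "\<And>e. e \<in> edges G \<Longrightarrow> 0 < len G e" using G by (simp add: compact_connected_graph_def)
  define w where "w p = (case p of Vertex x \<Rightarrow> Z x | Inner e t \<Rightarrow> Z (src G e))" for p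
  have w: "w (edge_point G e t) = Z (src G e)" if "e \<in> edges G" for e t
    using edge[OF that] by (simp add: w_def edge_point_def)
  have "openin (graph_topology G) {p \<in> points G. w p \<in> U}" for U
    unfolding openin_graph_topology
  proof (intro conjI ballI)
    fix e assume e: "e \<in> edges G"
    have "{t \<in> {0..len G e}. edge_point G e t \<in> {p \<in> points G. w p \<in> U}} =
        (if Z (src G e) \<in> U then {0..len G e} else {})"
      using edge_point_in_points[OF e] w[OF e] by auto
    then show "openin (top_of_set {0..len G e})
        {t \<in> {0..len G e}. edge_point G e t \<in> {p \<in> points G. w p \<in> U}}"
      by (simp del: mem_Collect_eq)
  qed auto
  from this[of "{0}"] this[of "-{0}"]
  have o: "openin (graph_topology G) {p \<in> points G. w p = 0}"
    "openin (graph_topology G) {p \<in> points G. w p \<noteq> 0}" by simp_all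
  have "connected_space (graph_topology G)" using G by (simp add: compact_connected_graph_def)
  moreover have "Vertex x0 \<in> {p \<in> points G. w p = 0}"
    using assms vertex_in_points[OF pos] by (simp add: w_def)
  moreover have "points G \<subseteq> {p \<in> points G. w p = 0} \<union> {p \<in> points G. w p \<noteq> 0}"
    "{p \<in> points G. w p = 0} \<inter> {p \<in> points G. w p \<noteq> 0} = {}" by auto
  ultimately have "{p \<in> points G. w p \<noteq> 0} = {}"
    using o unfolding connected_space_def topspace_graph_topology by blast
  then have "w (Vertex x) = 0"
    using \<open>x \<in> vertices G\<close> vertex_in_points[OF pos] by blast
  then show ?thesis by (simp add: w_def)
qed

text \<open>Pairing the Laplacian with Z gives 0 vertex by vertex, and regrouped by edges it is
  minus the Dirichlet energy. So Z is constant along edges, and a point of D supplies the value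
  0.\<close>

lemma graph_laplacian_injective:
  assumes G: "compact_connected_graph G" and D: "D \<subseteq> vertices G" "D \<noteq> {}"
    and Z: "\<And>x. x \<in> D \<Longrightarrow> Z x = 0"
    and harm: "\<And>x. x \<in> vertices G - D \<Longrightarrow> graph_laplacian G Z x = 0"
    and "x \<in> vertices G"
  shows "Z x = 0"
proof -
  have pos: "\<And>e. e \<in> edges G \<Longrightarrow> 0 < len G e" and fin: "finite (edges G)"
    using G by (auto simp: compact_connected_graph_def)
  have "0 = (\<Sum>x\<in>vertices G. Z x * graph_laplacian G Z x)"
  proof (rule sum.neutral[symmetric], rule ballI)
    fix x assume "x \<in> vertices G"
    then show "Z x * graph_laplacian G Z x = 0"
      using Z[of x] harm[of x] by (cases "x \<in> D") auto
  qed
  also have "\<dots> = (\<Sum>e\<in>edges G. - ((Z (tgt G e) - Z (src G e))\<^sup>2 / len G e))"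
    unfolding graph_laplacian_def sum_vertices_vertex_sum[OF fin]
  proof (rule sum.cong)
    fix e assume "e \<in> edges G"
    then show "Z (src G e) * ((Z (tgt G e) - Z (src G e)) / len G e) +
         Z (tgt G e) * ((Z (src G e) - Z (tgt G e)) / len G e) =
         - ((Z (tgt G e) - Z (src G e))\<^sup>2 / len G e)"
      using pos[of e] by (simp add: field_simps power2_eq_square)
  qed simp
  finally have "(\<Sum>e\<in>edges G. (Z (tgt G e) - Z (src G e))\<^sup>2 / len G e) = 0"
    by (simp add: sum_negf)
  then have "\<forall>e\<in>edges G. (Z (tgt G e) - Z (src G e))\<^sup>2 / len G e = 0"
    using pos by (subst (asm) sum_nonneg_eq_0_iff[OF fin]) (auto simp: less_imp_le)
  then have "Z (tgt G e) = Z (src G e)" if "e \<in> edges G" for e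
    using that pos[OF that] by auto
  then show ?thesis
    using constant_along_edges_zero[OF G _ _ _ \<open>x \<in> vertices G\<close>, of _ Z] D Z by blast
qed

lemma vertex_sum_sum:
  "vertex_sum G (\<lambda>e. \<Sum>y\<in>I. a y e * c y) (\<lambda>e. \<Sum>y\<in>I. b y e * c y) x =
    (\<Sum>y\<in>I. vertex_sum G (a y) (b y) x * c y)"
  by (simp add: vertex_sum_def distrib_right sum.distrib sum_distrib_right sum.swap[of _ I])

lemma graph_laplacian_sum:
  "graph_laplacian G (\<lambda>z. \<Sum>y\<in>I. f y z * c y) x = (\<Sum>y\<in>I. graph_laplacian G (f y) x * c y)"
proof -
  have "((\<Sum>y\<in>I. f y p * c y) - (\<Sum>y\<in>I. f y q * c y)) / l = (\<Sum>y\<in>I. (f y p - f y q) / l * c y)" for p q l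
    by (simp add: sum_divide_distrib sum_subtractf left_diff_distrib diff_divide_distrib)
  then show ?thesis
    by (simp only: graph_laplacian_def vertex_sum_sum)
qed

lemma torsion_function_exists:
  fixes G :: "('v, 'e) metric_graph"
  assumes G: "compact_connected_graph G" and D: "D \<subseteq> vertices G" "D \<noteq> {}"
  obtains X where "\<And>x. x \<in> D \<Longrightarrow> X x = 0"
    "\<And>x. x \<in> vertices G - D \<Longrightarrow> vertex_sum G (edge_slope G X) (\<lambda>e. len G e - edge_slope G X e) x = 0"
    "torsion_function G D = torsion_extension G X"
proof -
  have pos: "\<And>e. e \<in> edges G \<Longrightarrow> 0 < len G e" and fin: "finite (edges G)"
    using G by (auto simp: compact_connected_graph_def)
  define I where "I = vertices G - D"
  have finI: "finite I" using fin by (simp add: I_def vertices_def)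
  \<comment> \<open>The inhomogeneity: the curvature contributes half the edge length at each end of
    an edge.\<close>
  define cst where "cst = vertex_sum G (\<lambda>e. len G e / 2) (\<lambda>e. len G e / 2)"
  have K: "vertex_sum G (edge_slope G X) (\<lambda>e. len G e - edge_slope G X e) x = graph_laplacian G X x + cst x"
    for X x
  proof -
    have "len G e - edge_slope G X e = (X (src G e) - X (tgt G e)) / len G e + len G e / 2" for e
      by (simp add: edge_slope_def diff_divide_distrib)
    then show ?thesis
      by (simp add: graph_laplacian_def vertex_sum_def cst_def edge_slope_def sum.distrib)
  qed
  define \<delta> where "\<delta> y z = (if y = z then 1 else 0 :: real)" for y z :: 'v
  \<comment> \<open>The matrix has the columns \<open>graph_laplacian G (\<delta> y)\<close> over
    the free vertices; applying it to X amounts to extending X by zero before taking the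
    Laplacian.\<close>
  have lap: "(\<Sum>y\<in>I. graph_laplacian G (\<delta> y) x * X y) = graph_laplacian G (\<lambda>z. if z \<in> I then X z else 0) x"
    for X x
  proof -
    have "(\<Sum>y\<in>I. \<delta> y z * X y) = (if z \<in> I then X z else 0)" for z
      using finI by (simp add: \<delta>_def if_distrib[of "\<lambda>a. a * _"] cong: if_cong)
    then show ?thesis
      by (simp flip: graph_laplacian_sum)
  qed
  obtain X0 where X0: "\<And>x. x \<in> I \<Longrightarrow> (\<Sum>y\<in>I. graph_laplacian G (\<delta> y) x * X0 y) = - cst x"
  proof (rule square_system_solvable[OF finI, of "\<lambda>x y. graph_laplacian G (\<delta> y) x" "\<lambda>x. - cst x"])
    fix Z i assume Z: "\<And>i. i \<in> I \<Longrightarrow> (\<Sum>j\<in>I. graph_laplacian G (\<delta> j) i * Z j) = 0" and "i \<in> I"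
    have "graph_laplacian G (\<lambda>z. if z \<in> I then Z z else 0) x = 0" if "x \<in> vertices G - D" for x
      using Z[of x] that unfolding lap by (simp add: I_def)
    then have "(if i \<in> I then Z i else 0) = 0"
    proof (rule graph_laplacian_injective[OF G D, rotated])
      show "(if x \<in> I then Z x else 0) = 0" if "x \<in> D" for x
        using that by (simp add: I_def)
      show "i \<in> vertices G"
        using \<open>i \<in> I\<close> by (simp add: I_def)
    qed
    then show "Z i = 0" using \<open>i \<in> I\<close> by simp
  qed blast
  define X where "X z = (if z \<in> I then X0 z else 0)" for z
  have XD: "\<And>x. x \<in> D \<Longrightarrow> X x = 0" by (simp add: X_def I_def)
  have XK: "graph_laplacian G X x + cst x = 0" if "x \<in> vertices G - D" for x
    using X0[of x] that unfolding lap X_def[abs_def] by (simp add: I_def)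
  have "torsion_function G D = torsion_extension G X"
    unfolding torsion_function_def
  proof (rule the_equality)
    show "is_torsion_function G D (torsion_extension G X)"
      using XD XK by (subst is_torsion_function_torsion_extension[OF pos D(1)]) (auto simp: K)
  next
    fix v assume v: "is_torsion_function G D v"
    define Y where "Y x = v (Vertex x)" for x
    have vY: "v = torsion_extension G Y"
      using torsion_function_shape[OF pos v] by (simp add: Y_def[abs_def])
    with v have Y: "\<forall>x\<in>D. Y x = 0" "\<forall>x\<in>vertices G - D. graph_laplacian G Y x + cst x = 0"
      using is_torsion_function_torsion_extension[OF pos D(1), of Y] by (auto simp: K)
    \<comment> \<open>The constant terms cancel in the difference of two solutions, which therefore
      solves the homogeneous system.\<close>
    have sub: "graph_laplacian G (\<lambda>z. Y z - X z) x = graph_laplacian G Y x - graph_laplacian G X x" for x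
      by (simp add: graph_laplacian_def vertex_sum_def diff_divide_distrib sum_subtractf)
    have "graph_laplacian G (\<lambda>z. Y z - X z) x = 0" if "x \<in> vertices G - D" for x
      using Y(2)[rule_format, OF that] XK[OF that] unfolding sub by linarith
    then have "Y x - X x = 0" if "x \<in> vertices G" for x
      by (rule graph_laplacian_injective[OF G D, rotated]) (use that Y(1) XD in simp_all)
    then have eq: "Y x = X x" if "x \<in> vertices G" for x using that by simp
    show "v = torsion_extension G X"
    proof
      fix p
      show "v p = torsion_extension G X p"
      proof (cases "p \<in> points G")
        case True
        then obtain e t where "e \<in> edges G" "t \<in> {0..len G e}" "p = edge_point G e t" by (rule pointsE)
        then show ?thesis
          using on_edge_torsion_extension[of e G t Y] on_edge_torsion_extension[of e G t X] pos
            eq[of "src G e"] eq[of "tgt G e"]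
          by (simp add: vY on_edge_def edge_slope_def vertices_def)
      qed (simp add: vY torsion_extension_def)
    qed
  qed
  with XD XK show ?thesis by (intro that) (auto simp: K)
qed

section \<open>Cheeger quotients of superlevel sets\<close>

text \<open>The given S makes the set of quotients non-empty, without which its real infimum would
  carry no information. For a set of length 0 the second bound is trivial.\<close>

lemma cheeger_bound:
  assumes S: "subgraph G S" "S \<noteq> {}" "S \<inter> Vertex ` D = {}"
  shows "0 \<le> cheeger G D" and "cheeger G D * set_length G S \<le> real (boundary_size G S)"
proof -
  let ?R = "{real (boundary_size G S) / set_length G S | S.
     subgraph G S \<and> S \<noteq> {} \<and> S \<inter> Vertex ` D = {}}"
  have sl: "0 \<le> set_length G S" for S :: "('a, 'b) point set"
    unfolding set_length_def by (intro sum_nonneg) auto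
  have mem: "real (boundary_size G S) / set_length G S \<in> ?R"
    using S by blast
  show "0 \<le> cheeger G D"
    unfolding cheeger_def using mem sl by (intro cInf_greatest) auto
  have "cheeger G D \<le> real (boundary_size G S) / set_length G S"
    unfolding cheeger_def using mem sl by (intro cInf_lower bdd_belowI[of _ 0]) auto
  then show "cheeger G D * set_length G S \<le> real (boundary_size G S)"
    using sl[of S] by (cases "set_length G S = 0") (auto simp: field_simps)
qed

text \<open>Away from the apex values, each edge meets the superlevel set in a non-degenerate
  interval or not at all, according to the side of its maximum on which t lies.\<close>

lemma subgraph_superlevel:
  assumes fin: "finite (edges G)" and pos: "\<And>e. e \<in> edges G \<Longrightarrow> 0 < len G e"
    and cont: "continuous_map (graph_topology G) euclideanreal u"
    and on: "\<And>e s. e \<in> edges G \<Longrightarrow> s \<in> {0..len G e} \<Longrightarrow> on_edge G u e s = parab (\<alpha> e) (\<beta> e) s"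
    and t: "\<And>e. e \<in> edges G \<Longrightarrow> t \<noteq> parab (\<alpha> e) (\<beta> e) (apex (\<beta> e) (len G e))"
  shows "subgraph G {p \<in> points G. t \<le> u p}"
proof -
  let ?E = "{e \<in> edges G. t < parab (\<alpha> e) (\<beta> e) (apex (\<beta> e) (len G e))}"
  have "\<forall>e\<in>?E. \<exists>a b. 0 \<le> a \<and> a < b \<and> b \<le> len G e \<and>
      {s \<in> {0..len G e}. t \<le> parab (\<alpha> e) (\<beta> e) s} = {a..b}"
  proof
    fix e assume "e \<in> ?E"
    then have "0 < len G e" "t < parab (\<alpha> e) (\<beta> e) (apex (\<beta> e) (len G e))"
      using pos by auto
    then obtain a b where "0 \<le> a" "a < b" "b \<le> len G e"
      "{s \<in> {0..len G e}. t \<le> parab (\<alpha> e) (\<beta> e) s} = {a..b}"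
      by (rule parab_superlevel)
    then show "\<exists>a b. 0 \<le> a \<and> a < b \<and> b \<le> len G e \<and>
        {s \<in> {0..len G e}. t \<le> parab (\<alpha> e) (\<beta> e) s} = {a..b}"
      by blast
  qed
  then obtain a b where ab: "\<And>e. e \<in> ?E \<Longrightarrow> 0 \<le> a e \<and> a e < b e \<and> b e \<le> len G e"
    and eq: "\<And>e. e \<in> ?E \<Longrightarrow> {s \<in> {0..len G e}. t \<le> parab (\<alpha> e) (\<beta> e) s} = {a e..b e}"
    unfolding bchoice_iff by blast
  have empty: "{s \<in> {0..len G e}. t \<le> parab (\<alpha> e) (\<beta> e) s} = {}" if "e \<in> edges G - ?E" for e
    using that t[of e] parab_le_apex[of _ "len G e" "\<alpha> e" "\<beta> e"] by force
  define I where "I = (\<lambda>e. (e, a e, b e)) ` ?E"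
  have "{p \<in> points G. t \<le> u p} =
      (\<Union>e\<in>edges G. edge_point G e ` {s \<in> {0..len G e}. t \<le> parab (\<alpha> e) (\<beta> e) s})"
    using on by (fastforce simp: points_def on_edge_def)
  also have "\<dots> = (\<Union>e\<in>?E. edge_point G e ` {a e..b e})"
    using eq empty by (intro equalityI UN_least) (blast+)
  also have "\<dots> = (\<Union>(e, a, b)\<in>I. edge_point G e ` {a..b})"
    by (simp add: I_def)
  finally have "{p \<in> points G. t \<le> u p} = (\<Union>(e, a, b)\<in>I. edge_point G e ` {a..b})" .
  moreover have "finite I" "\<forall>(e, a, b)\<in>I. e \<in> edges G \<and> 0 \<le> a \<and> a < b \<and> b \<le> len G e"
    using fin ab by (auto simp: I_def)
  moreover have "closedin (graph_topology G) {p \<in> points G. t \<le> u p}"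
    using closedin_continuous_map_preimage[OF cont, of "{t..}"] by (simp add: topspace_graph_topology)
  ultimately show ?thesis
    unfolding subgraph_def by blast
qed

text \<open>The open set where u exceeds t lies in the interior, so the frontier is contained in the
  level set. A vertex on the level is counted once for every incident edge end, hence the
  inequality; finiteness is essential because \<open>card\<close> is 0 on infinite sets.\<close>

lemma boundary_size_superlevel_le:
  assumes fin: "finite (edges G)"
    and cont: "continuous_map (graph_topology G) euclideanreal u"
    and lev: "\<And>e. e \<in> edges G \<Longrightarrow> finite {s \<in> {0..len G e}. on_edge G u e s = t}"
  shows "boundary_size G {p \<in> points G. t \<le> u p} \<le>
    (\<Sum>e\<in>edges G. card {s \<in> {0..len G e}. on_edge G u e s = t})"
proof -
  let ?S = "{p \<in> points G. t \<le> u p}" and ?L = "\<lambda>e. {s \<in> {0..len G e}. on_edge G u e s = t}"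
  have "closedin (graph_topology G) ?S" "openin (graph_topology G) {p \<in> points G. t < u p}"
    using closedin_continuous_map_preimage[OF cont, of "{t..}"]
      openin_continuous_map_preimage[OF cont, of "{t<..}"] by (simp_all add: topspace_graph_topology)
  moreover from this(2) have "{p \<in> points G. t < u p} \<subseteq> graph_topology G interior_of ?S"
    by (intro interior_of_maximal) auto
  ultimately have "graph_topology G frontier_of ?S \<subseteq> {p \<in> points G. u p = t}"
    unfolding frontier_of_def by (auto simp: closure_of_closedin)
  also have "\<dots> \<subseteq> (\<Union>e\<in>edges G. edge_point G e ` ?L e)"
    by (auto simp: points_def on_edge_def)
  finally have "boundary_size G ?S \<le> card (\<Union>e\<in>edges G. edge_point G e ` ?L e)"
    unfolding boundary_size_def using fin lev by (intro card_mono) auto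
  also have "\<dots> \<le> (\<Sum>e\<in>edges G. card (edge_point G e ` ?L e))"
    by (rule card_UN_le[OF fin])
  also have "\<dots> \<le> (\<Sum>e\<in>edges G. card (?L e))"
    using lev by (intro sum_mono card_image_le)
  finally show ?thesis .
qed

theorem proposition5p3:
  fixes G :: "('v, 'e) metric_graph" and D :: "'v set"
  assumes "compact_connected_graph G"
    and "D \<subseteq> vertices G" and "D \<noteq> {}"
  shows "(cheeger G D)\<^sup>2 * torsional_rigidity G D < total_length G"
proof -
  have pos: "\<And>e. e \<in> edges G \<Longrightarrow> 0 < len G e" and fin: "finite (edges G)" and ne: "edges G \<noteq> {}"
    using assms(1) by (auto simp: compact_connected_graph_def)
  obtain X where X0: "\<And>x. x \<in> D \<Longrightarrow> X x = 0"
    and K: "\<And>x. x \<in> vertices G - D \<Longrightarrow>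
      vertex_sum G (edge_slope G X) (\<lambda>e. len G e - edge_slope G X e) x = 0"
    and tf: "torsion_function G D = torsion_extension G X"
    using torsion_function_exists[OF assms] by blast
  define u where "u = torsion_extension G X"
  let ?\<alpha> = "\<lambda>e. X (src G e)" and ?\<beta> = "edge_slope G X"
  let ?q = "\<lambda>e. parab (?\<alpha> e) (?\<beta> e)"
  define T where "T = (\<Sum>e\<in>edges G. integral {0..len G e} (?q e))"
  define V where "V = (\<Sum>e\<in>edges G. parab_variation (?\<alpha> e) (?\<beta> e) (len G e))"
  define L where "L = total_length G"
  define h where "h = cheeger G D"
  have on: "on_edge G u e s = ?q e s" if "e \<in> edges G" "s \<in> {0..len G e}" for e s
    unfolding u_def using that(1) pos[OF that(1)] that(2) by (rule on_edge_torsion_extension)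
  have cont: "continuous_map (graph_topology G) euclideanreal u"
    unfolding continuous_map_graph_topology
    by (intro ballI continuous_on_eq[OF continuous_on_parab]) (use on in simp)
  have uD: "u (Vertex x) = 0" if "x \<in> D" for x
    using that X0 vertex_in_points[OF pos] assms(2) by (auto simp: u_def torsion_extension_def)
  have "torsional_rigidity G D = (\<Sum>e\<in>edges G. LINT t|lebesgue_on {0..len G e}. ?q e t)"
    unfolding torsional_rigidity_def tf u_def[symmetric] using on
    by (intro sum.cong Bochner_Integration.integral_cong) auto
  then have T: "torsional_rigidity G D = T"
    unfolding T_def by (simp add: lebesgue_integral_continuous(2) continuous_on_parab)
  have L: "0 < L"
    unfolding L_def total_length_def using pos fin ne by (intro sum_pos)
  have energy: "(\<Sum>e\<in>edges G. (?\<beta> e ^ 3 - (?\<beta> e - len G e) ^ 3) / 3) = T"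
  proof -
    \<comment> \<open>Boundary terms of the integration by parts: at a Dirichlet vertex the value
      vanishes, at any other vertex the Kirchhoff sum does.\<close>
    have "0 = (\<Sum>x\<in>vertices G. X x * vertex_sum G ?\<beta> (\<lambda>e. len G e - ?\<beta> e) x)"
      using X0 K by (intro sum.neutral[symmetric] ballI) (metis DiffI mult_zero_left mult_zero_right)
    also have "\<dots> = (\<Sum>e\<in>edges G. X (src G e) * ?\<beta> e + X (tgt G e) * (len G e - ?\<beta> e))"
      by (rule sum_vertices_vertex_sum[OF fin])
    also have "\<dots> = (\<Sum>e\<in>edges G. integral {0..len G e} (?q e) - (?\<beta> e ^ 3 - (?\<beta> e - len G e) ^ 3) / 3)"
    proof (rule sum.cong)
      fix e assume e: "e \<in> edges G"
      show "X (src G e) * ?\<beta> e + X (tgt G e) * (len G e - ?\<beta> e) =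
          integral {0..len G e} (?q e) - (?\<beta> e ^ 3 - (?\<beta> e - len G e) ^ 3) / 3"
        using parab_energy[OF less_imp_le[OF pos[OF e]], of "?\<alpha> e" "?\<beta> e"]
        unfolding parab_edge_slope_len[where G = G and X = X, OF pos[OF e]] parab_0
        by (simp only: right_diff_distrib)
    qed simp
    finally show ?thesis by (simp add: T_def sum_subtractf)
  qed
  have AM_GM: "2 * c * V < T + c\<^sup>2 * L" for c
  proof -
    have "2 * c * V = (\<Sum>e\<in>edges G. 2 * c * parab_variation (?\<alpha> e) (?\<beta> e) (len G e))"
      by (simp add: V_def sum_distrib_left)
    also have "\<dots> < (\<Sum>e\<in>edges G. (?\<beta> e ^ 3 - (?\<beta> e - len G e) ^ 3) / 3 + c\<^sup>2 * len G e)"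
      using fin ne pos by (intro sum_strict_mono parab_variation_AM_GM)
    also have "\<dots> = T + c\<^sup>2 * L"
      unfolding sum.distrib energy by (simp add: L_def total_length_def sum_distrib_left)
    finally show ?thesis .
  qed
  \<comment> \<open>\<open>c = V / L\<close>, the mean of the absolute derivative, minimises
    \<open>T - 2 * c * V + c\<^sup>2 * L\<close>.\<close>
  have VL: "V\<^sup>2 < T * L"
    using AM_GM[of "V / L"] L by (simp add: field_simps power2_eq_square)
  have "0 \<le> V\<^sup>2" by simp
  with VL have "0 < T * L" by linarith
  then have "0 < T" using L by (simp add: zero_less_mult_iff)
  \<comment> \<open>At a level in \<open>F\<close> the superlevel set may have isolated points and fail to be a subgraph.\<close>
  define F where "F = (\<lambda>e. ?q e (apex (?\<beta> e) (len G e))) ` edges G"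
  have finF: "finite F" using fin by (simp add: F_def)
  let ?S = "\<lambda>t. {p \<in> points G. t \<le> u p}"
  \<comment> \<open>Positive levels keep the superlevel set away from D, where u is 0.\<close>
  have S: "subgraph G (?S t)" "?S t \<inter> Vertex ` D = {}" if "0 < t" "t \<notin> F" for t
    using that uD by (auto simp: F_def intro!: subgraph_superlevel[OF fin pos cont on])
  \<comment> \<open>One admissible subgraph has to be exhibited. As \<open>0 < T\<close>, u is
    positive somewhere, and since \<open>F\<close> is finite some level between 0 and that value
    avoids it.\<close>
  have "0 \<le> h"
  proof -
    obtain e where e: "e \<in> edges G" "0 < integral {0..len G e} (?q e)"
      using \<open>0 < T\<close> sum_nonpos[of "edges G" "\<lambda>e. integral {0..len G e} (?q e)"]
      unfolding T_def by force
    obtain s where s: "s \<in> {0..len G e}" "0 < ?q e s"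
    proof (rule ccontr)
      assume "\<not> thesis"
      then have "?q e s \<le> 0" if "s \<in> {0..len G e}" for s
        using \<open>\<And>s. s \<in> {0..len G e} \<Longrightarrow> 0 < ?q e s \<Longrightarrow> thesis\<close>[OF that] by linarith
      then have "integral {0..len G e} (?q e) \<le> integral {0..len G e} (\<lambda>_. 0)"
        by (intro integral_le integrable_continuous_real continuous_on_parab) auto
      with e(2) show False by simp
    qed
    have "infinite ({0<..<?q e s} - F)"
      using finF s(2) infinite_Ioo by (metis Diff_infinite_finite)
    then obtain t where t: "0 < t" "t < ?q e s" "t \<notin> F"
      by (metis Diff_iff greaterThanLessThan_iff infinite_imp_nonempty ex_in_conv)
    have "edge_point G e s \<in> ?S t"
      using edge_point_in_points[OF e(1) s(1)] on[OF e(1) s(1)] t by (simp add: on_edge_def)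
    then show ?thesis
      unfolding h_def using cheeger_bound(1)[OF S(1)[OF t(1,3)] _ S(2)[OF t(1,3)]] by blast
  qed
  have "h * T \<le> V"
    unfolding T_def V_def
  proof (rule isoperimetric_integral_le[OF less_imp_le[OF pos] \<open>0 \<le> h\<close> finF])
    fix t assume t: "0 < t" "t \<notin> F"
    have m: "set_length G (?S t) = (\<Sum>e\<in>edges G. measure lborel {s \<in> {0..len G e}. t \<le> ?q e s})"
      unfolding set_length_def
    proof (rule sum.cong)
      fix e assume e: "e \<in> edges G"
      have "{s \<in> {0..len G e}. edge_point G e s \<in> ?S t} = {s \<in> {0..len G e}. t \<le> ?q e s}"
        using on[OF e] edge_point_in_points[OF e] by (auto simp: on_edge_def)
      then show "measure lborel {s \<in> {0..len G e}. edge_point G e s \<in> ?S t} =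
          measure lborel {s \<in> {0..len G e}. t \<le> ?q e s}" by simp
    qed simp
    have lev: "{s \<in> {0..len G e}. on_edge G u e s = t} = {s \<in> {0..len G e}. ?q e s = t}"
      if "e \<in> edges G" for e
      using on[OF that] by auto
    have "finite {s \<in> {0..len G e}. on_edge G u e s = t}" if "e \<in> edges G" for e
      unfolding lev[OF that] using pos[OF that] by (intro card_parab_level) simp
    then have "boundary_size G (?S t) \<le> (\<Sum>e\<in>edges G. card {s \<in> {0..len G e}. on_edge G u e s = t})"
      by (rule boundary_size_superlevel_le[OF fin cont])
    also have "\<dots> = (\<Sum>e\<in>edges G. card {s \<in> {0..len G e}. ?q e s = t})"
      by (rule sum.cong[OF refl]) (simp only: lev)
    finally have "real (boundary_size G (?S t)) \<le> (\<Sum>e\<in>edges G. real (card {s \<in> {0..len G e}. ?q e s = t}))"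
      unfolding of_nat_sum[symmetric] by (rule of_nat_mono)
    moreover have "h * set_length G (?S t) \<le> real (boundary_size G (?S t))"
    \<comment> \<open>Above the maximum of u the superlevel set is empty and thus no competitor for
      the Cheeger constant, but its length is 0.\<close>
    proof (cases "?S t = {}")
      case True
      then show ?thesis by (simp only: True) (simp add: set_length_def)
    next
      case False
      then show ?thesis
        unfolding h_def by (intro cheeger_bound(2) S t)
    qed
    ultimately show "h * (\<Sum>e\<in>edges G. measure lborel {s \<in> {0..len G e}. t \<le> ?q e s}) \<le>
        (\<Sum>e\<in>edges G. real (card {s \<in> {0..len G e}. ?q e s = t}))"
      unfolding m by linarith
  qed
  then have "(h * T)\<^sup>2 \<le> V\<^sup>2"
    using \<open>0 \<le> h\<close> \<open>0 < T\<close> by (intro power_mono) auto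
  \<comment> \<open>\<open>h\<^sup>2 * T\<^sup>2 \<le> V\<^sup>2 < T * L\<close>; cancelling one
    positive factor \<open>T\<close> leaves the claim.\<close>
  with VL have "(h\<^sup>2 * T) * T < L * T"
    by (simp add: power2_eq_square mult_ac)
  then show ?thesis
    using \<open>0 < T\<close> by (simp add: T h_def L_def)
qed

end
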